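(* Let $P \in \mathcal{P}_d(n)$ be a polytope satisfying Property Z, and let $\mathcal{C}(P)$ be a simplicial complex with $|\mathcal{C}(P)| = \operatorname{bd} P$ whose vertices are exactly the points of $V(P)$. For any $p \in V(P)$, let $\mathcal{F}_p$ denote the family of the facets of $\mathcal{C}(P)$ containing $p$. For any $F \in \mathcal{F}_p$, set $A(F,p) = \operatorname{vol}_{d-1} \left( \operatorname{conv} \left( \left( V(F) \cup \{ o \} \right) \setminus \{ p \} \right) \right)$, and let $m(F,p)$ be the unit normal vector of the hyperplane spanned by $\left( V(F) \cup \{ o \} \right) \setminus \{p\}$, pointing in the direction of the half space containing $p$. Then \begin{enumerate} \item for every $p \in V(P)$ we have \[ p = \frac{m}{|m|}, \quad \mbox{where } m=\sum_{F \in \mathcal{F}_p} A(F,p)\, m(F,p), \mbox{ and} \] \item $P$ is simplicial. \end{enumerate}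
   Context: $\mathbb{S}^{d-1}$ is the unit sphere of $\mathbb{R}^d$ centered at the origin $o$; $|\cdot|$ is the Euclidean norm. A polytope means a convex polytope; $V(\cdot)$ denotes the vertex set. $\mathcal{P}_d(n)$ denotes the family of $d$-dimensional polytopes in $\mathbb{R}^d$ with exactly $n$ vertices, all lying on $\mathbb{S}^{d-1}$. $\operatorname{vol}_k$ is $k$-dimensional volume. The facets of $\mathcal{C}(P)$ are its $(d-1)$-dimensional simplices. The complex $\mathcal{C}(P)$ is oriented so that for each of its $(d-1)$-simplices $(p_{i_1},\ldots,p_{i_d})$ the determinant $|p_{i_1},\ldots,p_{i_d}|$ with these columns is positive. Property Z: a polytope $P \in \mathcal{P}_d(n)$ with $V(P)=\{p_1,\ldots,p_n\}$ satisfies Property Z if for each $i$ there is an open set $U_i \subset \mathbb{S}^{d-1}$ (open in $\mathbb{S}^{d-1}$) such that $p_i \in U_i$ and, for any $q \in U_i$, $\operatorname{vol}_d\left( \operatorname{conv} \left( (V(P) \setminus \{p_i\}) \cup \{q\} \right) \right) \leq \operatorname{vol}_d(P)$. *)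

theory Defs
  imports "HOL-Analysis.Analysis"
begin

definition vertices :: "'a::real_vector set \<Rightarrow> 'a set" where
  "vertices S = {v. v extreme_point_of S}"

definition inscribed_polytopes :: "nat \<Rightarrow> 'a::euclidean_space set set" where
  "inscribed_polytopes n =
     {P. polytope P \<and> aff_dim P = int DIM('a) \<and> card (vertices P) = n \<and> vertices P \<subseteq> sphere 0 1}"

definition property_Z :: "'a::euclidean_space set \<Rightarrow> bool" where
  "property_Z P \<longleftrightarrow>
     (\<forall>p \<in> vertices P. \<exists>U. openin (top_of_set (sphere 0 1)) U \<and> p \<in> U \<and>
        (\<forall>q \<in> U. measure lebesgue (convex hull ((vertices P - {p}) \<union> {q})) \<le> measure lebesgue P))"

definition simplicial_polytope :: "'a::euclidean_space set \<Rightarrow> bool" where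
  "simplicial_polytope P \<longleftrightarrow> polytope P \<and> (\<forall>F. F facet_of P \<longrightarrow> (\<exists>k. k simplex F))"

definition complex_vertices :: "'a::euclidean_space set set \<Rightarrow> 'a set" where
  "complex_vertices C = {v. {v} \<in> C}"

text \<open>The facets of a complex triangulating the boundary of a full-dimensional polytope
  are its simplices of codimension 1.\<close>

definition facets_at :: "'a::euclidean_space set set \<Rightarrow> 'a \<Rightarrow> 'a set set" where
  "facets_at C p = {F \<in> C. (int DIM('a) - 1) simplex F \<and> p \<in> F}"

text \<open>\<open>affine_frame k a b\<close>: the map \<open>affine_param k a b\<close> is an isometry of Euclidean \<open>k\<close>-space,
  represented by extensional functions on \<open>{..<k}\<close>, onto the \<open>k\<close>-dimensional affine subspace
  through \<open>a\<close> with orthonormal direction vectors \<open>b 0, \<dots>, b (k - 1)\<close>.\<close>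

definition affine_frame :: "nat \<Rightarrow> 'a::euclidean_space \<Rightarrow> (nat \<Rightarrow> 'a) \<Rightarrow> bool" where
  "affine_frame k a b \<longleftrightarrow> (\<forall>i<k. \<forall>j<k. b i \<bullet> b j = (if i = j then 1 else 0))"

definition affine_param :: "nat \<Rightarrow> 'a::euclidean_space \<Rightarrow> (nat \<Rightarrow> 'a) \<Rightarrow> (nat \<Rightarrow> real) \<Rightarrow> 'a" where
  "affine_param k a b x = a + (\<Sum>i<k. x i *\<^sub>R b i)"

text \<open>\<open>k\<close>-dimensional volume of a Borel set contained in some \<open>k\<close>-dimensional affine subspace:
  the Lebesgue measure of its isometric copy in Euclidean \<open>k\<close>-space. Any two frames whose
  subspaces contain the set give the same value, by invariance of Lebesgue measure under
  isometries (and both give 0 if the set is of affine dimension less than \<open>k\<close>). For \<open>k = 0\<close>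
  the volume of a point is 1. The value is unspecified for sets of affine dimension
  greater than \<open>k\<close>.\<close>

definition k_volume :: "nat \<Rightarrow> 'a::euclidean_space set \<Rightarrow> real" where
  "k_volume k S =
     (SOME v. \<exists>a b. affine_frame k a b \<and>
        S \<subseteq> affine_param k a b ` ({..<k} \<rightarrow>\<^sub>E UNIV) \<and>
        v = measure (\<Pi>\<^sub>M i\<in>{..<k}. lborel) {x \<in> {..<k} \<rightarrow>\<^sub>E UNIV. affine_param k a b x \<in> S})"

definition opposite_area :: "'a::euclidean_space set \<Rightarrow> 'a \<Rightarrow> real" where
  "opposite_area F p = k_volume (DIM('a) - 1) (convex hull ((vertices F \<union> {0}) - {p}))"

definition opposite_normal :: "'a::euclidean_space set \<Rightarrow> 'a \<Rightarrow> 'a" where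
  "opposite_normal F p =
     (THE u. norm u = 1 \<and>
        (\<exists>c. affine hull ((vertices F \<union> {0}) - {p}) = {x. u \<bullet> x = c} \<and> u \<bullet> p > c))"

end

theory Submission
  imports Defs
begin

text \<open>Why the theorem holds. Fix an interior point \<open>c\<close> of \<open>P\<close> and cone the \<open>(d - 1)\<close>-simplices of \<open>C\<close> from \<open>c\<close>. The
resulting simplices tile \<open>P\<close>. If a vertex \<open>p\<close> moves to a nearby point \<open>q\<close>, every simplex of the tiling that
contains \<open>p\<close> moves along, and the moved simplices still do not overlap: together they are the image of \<open>P\<close>
under \<open>x \<mapsto> x + h x *\<^sub>R (q - p)\<close>, where \<open>h\<close> is the piecewise linear hat function that is \<open>1\<close> at \<open>p\<close> and \<open>0\<close> at
\<open>c\<close> and at the other vertices; as \<open>h\<close> is Lipschitz, this map is injective for \<open>q\<close> close to \<open>p\<close>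
(\<open>hat_lipschitz\<close>, \<open>inj_on_perturb\<close>). The moved simplices lie in the convex hull of \<open>q\<close> and the remaining
vertices, and the volume of each is affine in \<open>q\<close>. Hence that hull has volume at least
\<open>vol P + g p \<bullet> (q - p)\<close>, where the gradient \<open>g p\<close> is a sum over the simplices at \<open>p\<close> (\<open>volume_lower_bound\<close>).
If \<open>C\<close> subdivides a facet of \<open>P\<close>, the hull can be strictly larger than the union of the moved simplices; this drives the second part.

By Property Z the linear function \<open>g p\<close> has a local maximum at \<open>p\<close> on the sphere, so \<open>g p\<close> is a multiple of \<open>p\<close>; the
factor is positive because \<open>g p \<bullet> (p - c)\<close> is the volume of the star of \<open>p\<close> and \<open>p \<bullet> c < 1\<close>
(\<open>gradient_parallel\<close>).

The origin is an interior point of \<open>P\<close>. Indeed the gradients of all vertices add up to zero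
(\<open>sum_gradient\<close>): for each simplex the derivatives of its volume with respect to all its vertices, the
apex included, cancel by translation invariance, and the derivatives with respect to the apex add up to zero since the
total volume is \<open>vol P\<close> for every choice of the interior apex. So the origin is a positive combination of all
vertices. If it were not interior, a hyperplane through it with \<open>P\<close> on one side would contain all of them.

Now take \<open>c = 0\<close>. A simplex with vertices \<open>0\<close>, \<open>p\<close> and further vertices \<open>B - {p}\<close> contributes to \<open>g p\<close> a vector normal to
the hyperplane spanned by \<open>0\<close> and \<open>B - {p}\<close>, and by ``base times height'' its length is a universal constant times the area of
the face opposite to \<open>p\<close> (\<open>simplex_volume_eq_k_volume\<close>). So \<open>g p\<close> is a positive multiple of the vector \<open>m\<close> of the
theorem, which gives the first claim.

For the second claim suppose that a facet \<open>G\<close> of \<open>P\<close> with outer normal \<open>n\<close> is not a simplex. It contains a simplex of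
\<open>C\<close> with vertex set \<open>B\<close>, and a vertex \<open>p\<close> outside \<open>B\<close>. If \<open>p\<close> moves outwards to \<open>q\<close>, the new hull contains, besides the moved
tiling, a simplex erected over \<open>B\<close> towards \<open>q\<close>, whose height is proportional to \<open>n \<bullet> (q - p)\<close>
(\<open>volume_lower_bound_strict\<close>). This is a first-order gain, whereas \<open>g p \<bullet> (q - p)\<close> is of second order on the sphere because
\<open>g p\<close> is parallel to \<open>p\<close>. Property Z is violated.\<close>

section \<open>Coordinates indexed by a well-ordered type\<close>

text \<open>The determinant formula for the volume of a simplex lives on coordinates with a well-ordered index
type. Volumes over an arbitrary finite index type are obtained by relabelling the coordinates with this type, which has
as many elements.\<close>

typedef (overloaded) ('n::finite) ordered_copy = "{..<CARD('n)}"
  by (auto intro!: exI[of _ 0])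

instantiation ordered_copy :: (finite) linorder
begin
definition "a \<le> b \<longleftrightarrow> Rep_ordered_copy a \<le> Rep_ordered_copy b"
definition "a < b \<longleftrightarrow> Rep_ordered_copy a < Rep_ordered_copy b"
instance
  by standard (auto simp: less_eq_ordered_copy_def less_ordered_copy_def Rep_ordered_copy_inject)
end

lemma bij_Rep_ordered_copy:
  "bij_betw Rep_ordered_copy (UNIV :: 'n::finite ordered_copy set) {..<CARD('n)}"
  unfolding bij_betw_def
  using type_definition.Rep_range[OF type_definition_ordered_copy] 
  by (auto simp: inj_on_def Rep_ordered_copy_inject)

instance ordered_copy :: (finite) finite
  by standard (metis bij_Rep_ordered_copy bij_betw_finite finite_lessThan)

instance ordered_copy :: (finite) wellorder
proof
  fix Q :: "'a ordered_copy \<Rightarrow> bool" and a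
  assume *: "\<And>x. (\<And>y. y < x \<Longrightarrow> Q y) \<Longrightarrow> Q x"
  have "wf {(x, y). x < (y :: 'a ordered_copy)}"
    using wf_measure[of Rep_ordered_copy]
    by (rule wf_subset) (auto simp: less_ordered_copy_def)
  then show "Q a"
    by (rule wf_induct_rule) (use * in auto)
qed

lemma card_ordered_copy: "CARD('n ordered_copy) = CARD('n::finite)"
  using bij_betw_same_card[OF bij_Rep_ordered_copy] by simp

lemma ex_bij_ordered_copy: "\<exists>\<sigma> :: 'n::finite ordered_copy \<Rightarrow> 'n. bij \<sigma>"
  using finite_same_card_bij[OF finite finite card_ordered_copy] .

lemma prod_Basis_vec: "(\<Prod>b\<in>Basis. (x::real^'n::finite) \<bullet> b) = (\<Prod>i\<in>UNIV. x $ i)"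
proof -
  have "bij_betw (\<lambda>i. axis i 1) UNIV (Basis :: (real^'n) set)"
    by (auto simp: bij_betw_def inj_on_def axis_eq_axis Basis_vec_def)
  from prod.reindex_bij_betw[OF this, of "\<lambda>b. x \<bullet> b"] show ?thesis
    by (simp add: inner_axis)
qed

lemma compact_image_linear:
  fixes f :: "'a::euclidean_space \<Rightarrow> 'b::real_normed_vector"
  shows "linear f \<Longrightarrow> compact S \<Longrightarrow> compact (f ` S)"
  by (simp add: compact_continuous_image linear_continuous_on linear_conv_bounded_linear)

text \<open>Relabelling coordinates maps boxes to boxes of the same volume, and boxes determine Lebesgue
measure.\<close>

lemma distr_lborel_reindex:
  fixes \<sigma> :: "'m::finite \<Rightarrow> 'n::finite"
  assumes "bij \<sigma>"
  shows "distr lborel borel (\<lambda>x::real^'n. (\<chi> i. x $ \<sigma> i) :: real^'m) = lborel" (is "distr _ _ ?T = _")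
proof (rule lborel_eqI[symmetric])
  have T: "?T \<in> borel_measurable borel"
    by (intro borel_measurable_continuous_onI continuous_intros)
  show "emeasure (distr lborel borel ?T) (box l u) = (\<Prod>b\<in>Basis. (u - l) \<bullet> b)"
    if lu: "\<And>b. b \<in> Basis \<Longrightarrow> l \<bullet> b \<le> u \<bullet> b" for l u
  proof -
    define l' u' where "l' = (\<chi> j. l $ inv \<sigma> j)" and "u' = (\<chi> j. u $ inv \<sigma> j)"
    have inv: "inv \<sigma> (\<sigma> i) = i" "\<sigma> (inv \<sigma> j) = j" for i j
      using assms by (auto simp: bij_is_inj bij_is_surj surj_f_inv_f)
    have "?T -` box l u \<inter> space lborel = box l' u'"
      apply (auto simp: mem_box_cart l'_def u'_def inv)
       apply (metis inv)+
      done
    then have "emeasure (distr lborel borel ?T) (box l u) = emeasure lborel (box l' u')"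
      using T by (simp add: emeasure_distr)
    also have "\<dots> = (\<Prod>b\<in>Basis. (u' - l') \<bullet> b)"
    proof (rule emeasure_lborel_box)
      show "l' \<bullet> b \<le> u' \<bullet> b" if "b \<in> Basis" for b
      proof -
        have "l $ i \<le> u $ i" for i
          using lu[of "axis i 1"] by (simp add: inner_axis axis_in_Basis_iff)
        then show ?thesis
          using that by (auto simp: Basis_vec_def inner_axis l'_def u'_def)
      qed
    qed
    also have "(\<Prod>b\<in>Basis. (u' - l') \<bullet> b) = (\<Prod>j\<in>UNIV. (u' - l') $ j)"
      by (simp only: prod_Basis_vec)
    also have "\<dots> = (\<Prod>i\<in>UNIV. (u - l) $ i)"
      by (subst prod.reindex_bij_betw[OF assms, symmetric]) (simp add: l'_def u'_def inv)
    also have "\<dots> = (\<Prod>b\<in>Basis. (u - l) \<bullet> b)"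
      by (simp only: prod_Basis_vec)
    finally show ?thesis .
  qed
qed simp

lemma measure_lborel_compact:
  fixes S :: "'a::euclidean_space set"
  shows "compact S \<Longrightarrow> measure lborel S = measure lebesgue S"
  by (simp add: borel_compact measure_completion)

lemma coordinate_isometry_ordered_copy:
  obtains \<tau> :: "real^'n::finite \<Rightarrow> real^('n ordered_copy)" and \<rho>
  where "linear \<tau>" "linear \<rho>" "\<And>x. \<rho> (\<tau> x) = x" "\<And>y. \<tau> (\<rho> y) = y" "\<And>x y. \<tau> x \<bullet> \<tau> y = x \<bullet> y"
    "\<And>S. compact S \<Longrightarrow> measure lebesgue (\<tau> ` S) = measure lebesgue S"
proof -
  obtain \<sigma> :: "'n ordered_copy \<Rightarrow> 'n" where \<sigma>: "bij \<sigma>"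
    using ex_bij_ordered_copy by blast
  define \<tau> :: "real^'n \<Rightarrow> real^('n ordered_copy)" where "\<tau> = (\<lambda>x. \<chi> i. x $ \<sigma> i)"
  have inv: "inv \<sigma> (\<sigma> i) = i" "\<sigma> (inv \<sigma> j) = j" for i j
    using \<sigma> by (auto simp: bij_is_inj bij_is_surj surj_f_inv_f)
  have lin: "linear \<tau>"
    by (rule linearI) (auto simp: \<tau>_def vec_eq_iff)
  define \<rho> :: "real^('n ordered_copy) \<Rightarrow> real^'n" where "\<rho> = (\<lambda>y. \<chi> j. y $ inv \<sigma> j)"
  have lin': "linear \<rho>"
    by (rule linearI) (auto simp: \<rho>_def vec_eq_iff)
  have inverse: "\<rho> (\<tau> x) = x" "\<tau> (\<rho> y) = y" for x y
    by (simp_all add: \<tau>_def \<rho>_def vec_eq_iff inv)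
  have inner: "\<tau> x \<bullet> \<tau> y = x \<bullet> y" for x y
    unfolding inner_vec_def \<tau>_def
    by (simp add: sum.reindex_bij_betw[OF \<sigma>, of "\<lambda>i. x $ i * y $ i"])
  have meas: "measure lebesgue (\<tau> ` S) = measure lebesgue S" if "compact S" for S
  proof -
    have cpt: "compact (\<tau> ` S)"
      using that lin by (simp add: compact_image_linear)
    have "measure lborel (\<tau> ` S) = measure (distr lborel borel \<tau>) (\<tau> ` S)"
      by (simp add: distr_lborel_reindex[OF \<sigma>] \<tau>_def)
    also have "\<dots> = measure lborel (\<tau> -` \<tau> ` S \<inter> space lborel)"
      using cpt lin
      by (intro measure_distr) 
        (auto intro!: borel_measurable_continuous_onI linear_continuous_on simp: linear_conv_bounded_linear borel_compact)
    also have "\<tau> -` \<tau> ` S \<inter> space lborel = S"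
      using inverse by (auto simp: image_iff) metis
    finally show ?thesis
      using that cpt by (simp add: measure_lborel_compact)
  qed
  show thesis
    by (rule that[OF lin lin' inverse inner meas])
qed

text \<open>Conjugating with the relabelling reduces both facts to the determinant formula over a well-ordered
index type. The scaling factor is the same for all sets, so it cancels from ratios of volumes.\<close>

lemma
  fixes f :: "real^'n::finite \<Rightarrow> real^'n"
  assumes "linear f"
  shows linear_image_scales_measure:
      "\<exists>c\<ge>0. \<forall>S. compact S \<longrightarrow> measure lebesgue (f ` S) = c * measure lebesgue S" (is ?scale)
    and measure_isometry_image:
      "\<lbrakk>\<And>x y. f x \<bullet> f y = x \<bullet> y; compact S\<rbrakk> \<Longrightarrow> measure lebesgue (f ` S) = measure lebesgue S" (is "PROP ?iso")
proof -
  obtain \<tau> :: "real^'n \<Rightarrow> real^('n ordered_copy)" and \<rho>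
  where \<tau>: "linear \<tau>" "linear \<rho>" and inv: "\<And>x. \<rho> (\<tau> x) = x" "\<And>y. \<tau> (\<rho> y) = y" and inner: "\<And>x y. \<tau> x \<bullet> \<tau> y = x \<bullet> y"
    and meas: "\<And>S. compact S \<Longrightarrow> measure lebesgue (\<tau> ` S) = measure lebesgue S"
    by (rule coordinate_isometry_ordered_copy) blast
  define g where "g = \<tau> \<circ> f \<circ> \<rho>"
  have lin: "linear g"
    unfolding g_def using \<tau> assms by (intro linear_compose)
  have cpt: "compact (f ` S)" "compact (\<tau> ` S)" if "compact S" for S
    using that \<tau> assms by (simp_all add: compact_image_linear)
  have g: "\<tau> ` f ` S = g ` \<tau> ` S" for S
    by (simp add: g_def image_comp o_def inv)
  have "measure lebesgue (f ` S) = measure lebesgue (g ` \<tau> ` S)" if "compact S" for S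
    using meas[OF cpt(1)[OF that]] by (simp add: g)
  then have *: "measure lebesgue (f ` S) = \<bar>det (matrix g)\<bar> * measure lebesgue S" if "compact S" for S
    using that measure_linear_image[OF lin lmeasurable_compact[OF cpt(2)]] by (simp add: meas)
  then show ?scale
    by (intro exI[of _ "\<bar>det (matrix g)\<bar>"]) auto
  show "PROP ?iso"
  proof -
    assume f: "\<And>x y. f x \<bullet> f y = x \<bullet> y" and S: "compact S"
    have "g x \<bullet> g y = x \<bullet> y" for x y
      using inner[of "\<rho> x" "\<rho> y"] by (simp add: g_def inner f inv)
    then have "orthogonal_transformation g"
      using lin by (simp add: orthogonal_transformation_def)
    then have "\<bar>det (matrix g)\<bar> = 1"
      by (simp add: orthogonal_transformation_det)
    then show ?thesis
      using *[OF S] by simp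
  qed
qed

section \<open>Moving one vertex of a simplex\<close>

lemma negligible_aff_dim:
  fixes S :: "'a::euclidean_space set"
  assumes "aff_dim S < DIM('a)"
  shows "negligible S"
proof -
  have "aff_dim (affine hull S) < DIM('a)"
    using assms by simp
  then have "interior (affine hull S) = {}"
    by (metis aff_dim_nonempty_interior less_irrefl)
  then have "negligible (affine hull S)"
    by (intro negligible_convex_interior[THEN iffD2]) auto
  then show ?thesis
    by (rule negligible_subset) (rule hull_subset)
qed

lemma negligible_convex_hull_card:
  fixes S :: "'a::euclidean_space set"
  assumes "finite S" "card S \<le> DIM('a)"
  shows "negligible (convex hull S)"
  using aff_dim_le_card[OF assms(1)] assms(2)
  by (intro negligible_aff_dim) (simp add: aff_dim_convex_hull)

text \<open>Along a moving vertex the volume of a simplex is proportional to the distance to the opposite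
face. In coordinates this is Cramer's rule: replacing the column of \<open>p\<close> by that of \<open>q\<close> multiplies the determinant by the
coordinate of \<open>q\<close> belonging to \<open>p\<close>, which is the value at \<open>q\<close> of the affine function that is \<open>1\<close> at \<open>p\<close> and \<open>0\<close> at the
other vertices.\<close>

lemma simplex_volume_move_vertex_ordered:
  fixes X :: "(real^'n::{finite,wellorder}) set"
  assumes X: "card X = Suc CARD('n)" "affine hull X = UNIV" and p: "p \<in> X"
    and e1: "e \<bullet> p + c = 1" and e0: "\<And>v. v \<in> X - {p} \<Longrightarrow> e \<bullet> v + c = 0"
  shows "measure lebesgue (convex hull (insert q (X - {p}))) = \<bar>e \<bullet> q + c\<bar> * measure lebesgue (convex hull X)"
proof (cases "q \<in> X - {p}")
  case True
  have fin: "finite X"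
    using X(1) card.infinite by fastforce
  have "negligible (convex hull (X - {p}))"
    using fin X p by (intro negligible_convex_hull_card) auto
  then show ?thesis
    using True e0[OF True] by (simp add: insert_absorb negligible_imp_measure0)
next
  case False
  have fin: "finite X"
    using X(1) card.infinite by fastforce
  have "card (X - {p}) = CARD('n)"
    using fin X p by simp
  then have "X - {p} \<noteq> {}"
    using card_gt_0_iff[of "X - {p}"] by fastforce
  then obtain v0 where v0: "v0 \<in> X" "v0 \<noteq> p" by auto
  have "card (X - {v0}) = CARD('n)"
    using fin X v0 by simp
  then obtain f :: "'n \<Rightarrow> real^'n::_" where f: "bij_betw f UNIV (X - {v0})"
    by (metis fin finite_Diff finite_same_card_bij finite)
  then obtain k where k: "f k = p"
    using p v0 unfolding bij_betw_def by (metis DiffI empty_iff imageE insert_iff)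
  define M where "M = (\<chi> i. \<chi> j. f j $ i - v0 $ i)"
  have Mv: "M *v axis j 1 = f j - v0" for j
    by (simp add: M_def matrix_vector_mult_basis column_def vec_eq_iff)
  have "q \<in> affine hull X" using X by simp
  then have "q - v0 \<in> span ((\<lambda>x. x - v0) ` (X - {v0}))"
    by (auto simp: affine_hull_span[OF v0(1)] Setcompr_eq_image set_diff_eq image_Collect)
  moreover have "span ((\<lambda>x. x - v0) ` (X - {v0})) \<subseteq> range ((*v) M)"
  proof (intro span_minimal linear_subspace_image matrix_vector_mul_linear subspace_UNIV image_subsetI)
    fix v assume "v \<in> X - {v0}"
    then obtain j where "v = f j"
      using f by (auto simp: bij_betw_def)
    then show "v - v0 \<in> range ((*v) M)"
      by (metis Mv rangeI)
  qed
  ultimately obtain x where x: "q - v0 = M *v x" by auto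
  have "e \<bullet> q + c = e \<bullet> (q - v0)"
    using e0[of v0] v0 by (simp add: inner_diff_right)
  also have "q - v0 = (\<Sum>j\<in>UNIV. x $ j *\<^sub>R (f j - v0))"
    unfolding x by (simp add: M_def vec_eq_iff matrix_vector_mult_def mult.commute)
  also have "e \<bullet> \<dots> = (\<Sum>j\<in>UNIV. x $ j * (if j = k then 1 else 0))"
    unfolding inner_sum_right inner_scaleR_right
  proof (intro sum.cong refl arg_cong2[where f = "(*)"])
    fix j
    have "f j \<in> X - {p}" if "j \<noteq> k"
      using that k f unfolding bij_betw_def inj_on_def by (metis DiffD1 DiffI UNIV_I image_eqI singletonD)
    then show "e \<bullet> (f j - v0) = (if j = k then 1 else 0)"
      using e1 e0[of v0] e0[of "f j"] v0 k by (auto simp: inner_diff_right)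
  qed
  also have "\<dots> = x $ k"
    by (subst sum.remove[of _ k]) auto
  finally have xk: "e \<bullet> q + c = x $ k" .
  let ?X' = "insert q (X - {p})"
  define f' where "f' = f(k := q)"
  have f': "bij_betw f' UNIV (?X' - {v0})"
  proof -
    have "f ` (UNIV - {k}) = X - {v0} - {p}"
      using f k by (subst inj_on_image_set_diff[of f UNIV]) (auto simp: bij_betw_def)
    then have "f' ` UNIV = ?X' - {v0}"
      using False v0 by (auto simp: f'_def image_iff) 
    moreover have "card (?X' - {v0}) = CARD('n)"
      using fin X p v0 False by (simp add: card_Diff_singleton)
    ultimately show ?thesis
      unfolding bij_betw_def by (metis eq_card_imp_inj_on finite)
  qed
  have card': "card ?X' = Suc CARD('n)"
    using fin X p False by simp
  have "measure lebesgue (convex hull ?X') = \<bar>det (\<chi> i. \<chi> j. f' j $ i - v0 $ i)\<bar> / fact CARD('n)"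
    using content_simplex[OF _ card' _ f'] fin v0
    by (simp add: measure_lborel_compact finite_imp_compact_convex_hull)
  also have "(\<chi> i. \<chi> j. f' j $ i - v0 $ i) = (\<chi> i j. if j = k then (M *v x) $ i else M $ i $ j)"
    unfolding x[symmetric] by (simp add: vec_eq_iff f'_def M_def)
  also have "det \<dots> = (e \<bullet> q + c) * det M"
    by (simp only: cramer_lemma xk)
  also have "\<bar>(e \<bullet> q + c) * det M\<bar> / fact CARD('n) = \<bar>e \<bullet> q + c\<bar> * measure lebesgue (convex hull X)"
    using content_simplex[OF fin X(1) v0(1) f] fin
    by (simp add: measure_lborel_compact finite_imp_compact_convex_hull M_def abs_mult)
  finally show ?thesis .
qed

lemma simplex_volume_move_vertex:
  fixes X :: "(real^'n::finite) set"
  assumes X: "card X = Suc CARD('n)" "affine hull X = UNIV" and p: "p \<in> X"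
    and e1: "e \<bullet> p + c = 1" and e0: "\<And>v. v \<in> X - {p} \<Longrightarrow> e \<bullet> v + c = 0"
  shows "measure lebesgue (convex hull (insert q (X - {p}))) = \<bar>e \<bullet> q + c\<bar> * measure lebesgue (convex hull X)"
proof -
  obtain \<tau> :: "real^'n \<Rightarrow> real^('n ordered_copy)" and \<rho>
  where \<tau>: "linear \<tau>" "linear \<rho>" and inv: "\<And>x. \<rho> (\<tau> x) = x" "\<And>y. \<tau> (\<rho> y) = y"
    and inner: "\<And>x y. \<tau> x \<bullet> \<tau> y = x \<bullet> y"
    and meas: "\<And>S. compact S \<Longrightarrow> measure lebesgue (\<tau> ` S) = measure lebesgue S"
    by (rule coordinate_isometry_ordered_copy) blast
  have inj: "inj \<tau>" by (metis injI inv(1))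
  have fin: "finite X"
    using X(1) card.infinite by fastforce
  have *: "measure lebesgue (convex hull (\<tau> ` A)) = measure lebesgue (convex hull A)" if "finite A" for A
    using that meas[of "convex hull A"] \<tau>
    by (simp add: convex_hull_linear_image finite_imp_compact_convex_hull)
  have card: "card (\<tau> ` X) = Suc CARD('n ordered_copy)"
    using X card_ordered_copy[where 'n = 'n] inj by (simp add: card_image inj_on_subset)
  have "affine hull (\<tau> ` X) = UNIV"
  proof -
    have "affine hull (\<tau> ` X) = range \<tau>"
      using affine_hull_linear_image[of \<tau> X] X \<tau>(1) by (simp add: linear_conv_bounded_linear)
    also have "\<dots> = UNIV"
      by (metis inv(2) surjI)
    finally show ?thesis .
  qed
  then have main: "measure lebesgue (convex hull (insert (\<tau> q) (\<tau> ` X - {\<tau> p}))) =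
      \<bar>\<tau> e \<bullet> \<tau> q + c\<bar> * measure lebesgue (convex hull (\<tau> ` X))"
  proof (rule simplex_volume_move_vertex_ordered[OF card])
    show "\<tau> p \<in> \<tau> ` X" using p by simp
    show "\<tau> e \<bullet> \<tau> p + c = 1" by (simp add: inner e1)
    show "\<tau> e \<bullet> v + c = 0" if v: "v \<in> \<tau> ` X - {\<tau> p}" for v
    proof -
      obtain x where "x \<in> X" "v = \<tau> x" using v by blast
      with v e0[of x] show ?thesis by (auto simp: inner)
    qed
  qed
  have "insert (\<tau> q) (\<tau> ` X - {\<tau> p}) = \<tau> ` insert q (X - {p})"
    using inj by (auto simp: inj_eq)
  then show ?thesis
    using main *[of X] *[of "insert q (X - {p})"] fin by (simp only: inner finite_insert finite_Diff)
qed

section \<open>Codimension-one volume as prism volume\<close>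

text \<open>The product measure in which \<open>k_volume\<close> is computed is Lebesgue measure on Euclidean space, up to the
representation of points; as before it suffices to compare boxes.\<close>

lemma distr_PiM_lborel_vec:
  assumes \<sigma>: "bij_betw \<sigma> (UNIV :: 'n::finite set) {..<n::nat}"
  shows "distr (\<Pi>\<^sub>M i\<in>{..<n}. lborel) borel (\<lambda>x. (\<chi> i. x (\<sigma> i)) :: real^'n) = lborel"
    (is "distr ?M _ ?T = _")
    and "(\<lambda>x. (\<chi> i. x (\<sigma> i)) :: real^'n) \<in> borel_measurable (\<Pi>\<^sub>M i\<in>{..<n}. lborel)"
proof -
  interpret product_sigma_finite "\<lambda>i::nat. lborel :: real measure"
    by standard
  have \<sigma>n: "\<sigma> i < n" for i
    using \<sigma> by (auto simp: bij_betw_def)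
  show T: "?T \<in> borel_measurable ?M"
    unfolding borel_measurable_euclidean_space[of ?T]
  proof
    fix b :: "real^'n" assume "b \<in> Basis"
    then obtain i where "b = axis i 1" by (auto simp: Basis_vec_def)
    then show "(\<lambda>x. ?T x \<bullet> b) \<in> borel_measurable ?M"
      using \<sigma>n[of i] measurable_component_singleton[of "\<sigma> i" "{..<n}" "\<lambda>_. lborel :: real measure"]
      by (simp add: inner_axis)
  qed
  show "distr ?M borel ?T = lborel"
  proof (rule lborel_eqI[symmetric])
    show "emeasure (distr ?M borel ?T) (box l u) = (\<Prod>b\<in>Basis. (u - l) \<bullet> b)"
      if lu: "\<And>b. b \<in> Basis \<Longrightarrow> l \<bullet> b \<le> u \<bullet> b" for l u
    proof -
      have lu': "l $ i \<le> u $ i" for i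
        using lu[of "axis i 1"] by (simp add: inner_axis axis_in_Basis_iff)
      define \<tau> where "\<tau> = the_inv_into UNIV \<sigma>"
      have \<tau>: "\<tau> (\<sigma> i) = i" for i
        using \<sigma> unfolding \<tau>_def bij_betw_def by (simp add: the_inv_into_f_f)
      have \<sigma>\<tau>: "\<exists>i. j = \<sigma> i" if "j < n" for j
      proof -
        have "j \<in> range \<sigma>" using \<sigma> that by (simp add: bij_betw_def)
        then show ?thesis by blast
      qed
      have "?T -` box l u \<inter> space ?M = (\<Pi>\<^sub>E j\<in>{..<n}. {l $ \<tau> j<..<u $ \<tau> j})"
      proof (intro set_eqI iffI)
        fix x assume x: "x \<in> ?T -` box l u \<inter> space ?M"
        have "x j \<in> {l $ \<tau> j<..<u $ \<tau> j}" if j: "j < n" for j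
        proof -
          obtain i where "j = \<sigma> i" using \<sigma>\<tau>[OF j] by blast
          then show ?thesis using x by (simp add: mem_box_cart \<tau>)
        qed
        then show "x \<in> (\<Pi>\<^sub>E j\<in>{..<n}. {l $ \<tau> j<..<u $ \<tau> j})"
          using x by (simp add: space_PiM PiE_iff)
      next
        fix x assume x: "x \<in> (\<Pi>\<^sub>E j\<in>{..<n}. {l $ \<tau> j<..<u $ \<tau> j})"
        have "x (\<sigma> i) \<in> {l $ i<..<u $ i}" for i
          using PiE_mem[OF x, of "\<sigma> i"] \<sigma>n[of i] by (simp add: \<tau>)
        then show "x \<in> ?T -` box l u \<inter> space ?M"
          using x by (simp add: mem_box_cart space_PiM PiE_iff)
      qed
      then have "emeasure (distr ?M borel ?T) (box l u) = (\<Prod>j<n. emeasure lborel {l $ \<tau> j<..<u $ \<tau> j})"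
        using T by (simp add: emeasure_distr emeasure_PiM)
      also have "\<dots> = (\<Prod>i\<in>UNIV. emeasure lborel {l $ i<..<u $ i})"
        by (subst prod.reindex_bij_betw[OF \<sigma>, symmetric]) (simp add: \<tau>)
      also have "\<dots> = (\<Prod>i\<in>UNIV. ennreal ((u - l) $ i))"
        using lu' by simp
      also have "\<dots> = (\<Prod>b\<in>Basis. (u - l) \<bullet> b)"
        using lu' by (simp add: prod_Basis_vec prod_ennreal)
      finally show ?thesis .
    qed
  qed simp
qed

lemma mem_image_diff: "x \<in> (\<lambda>x. x - a) ` A \<longleftrightarrow> x + a \<in> A" for a :: "'a::group_add"
proof
  assume "x + a \<in> A"
  then show "x \<in> (\<lambda>x. x - a) ` A"
    by (rule rev_image_eqI) simp
qed auto

text \<open>The measure that a frame assigns to a set in a hyperplane is the volume of the prism of height one over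
the set. The frame, completed by the unit normal, gives an isometry onto Euclidean space under which the prism becomes a
product with the unit interval, so Fubini applies.\<close>

lemma frame_measure_eq_prism:
  fixes S :: "(real^'n::finite) set"
  assumes S: "compact S" and frame: "affine_frame k a b" and k: "CARD('n) = Suc k"
    and sub: "S \<subseteq> affine_param k a b ` ({..<k} \<rightarrow>\<^sub>E UNIV)"
    and w: "norm w = 1" "\<And>i. i < k \<Longrightarrow> b i \<bullet> w = 0"
  shows "measure (\<Pi>\<^sub>M i\<in>{..<k}. lborel) {x \<in> {..<k} \<rightarrow>\<^sub>E UNIV. affine_param k a b x \<in> S} =
    measure lebesgue ((\<lambda>(s, t). s + t *\<^sub>R w) ` (S \<times> {0..1}))" (is "measure ?M ?S' = measure _ ?Q")
proof -
  define b' where "b' = b(k := w)"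
  have ww: "w \<bullet> w = 1" using w(1) by (simp add: norm_eq_1)
  have b': "b' i \<bullet> b' j = (if i = j then 1 else 0)" if "i < Suc k" "j < Suc k" for i j
    using that frame w(2) ww unfolding b'_def affine_frame_def
    by (auto simp: less_Suc_eq inner_commute)
  obtain \<sigma> :: "'n \<Rightarrow> nat" where \<sigma>: "bij_betw \<sigma> UNIV {..<Suc k}"
    using k by (metis card_lessThan finite finite_lessThan finite_same_card_bij)
  have \<sigma>n: "\<sigma> i < Suc k" for i
    using \<sigma> by (auto simp: bij_betw_def)
  have \<sigma>inj: "\<sigma> i = \<sigma> j \<longleftrightarrow> i = j" for i j
    using \<sigma> by (auto simp: bij_betw_def inj_eq)
  define T where "T = (\<lambda>y::real^'n. \<Sum>i\<in>UNIV. y $ i *\<^sub>R b' (\<sigma> i))"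
  define T' where "T' = (\<lambda>z::real^'n. (\<chi> i. z \<bullet> b' (\<sigma> i)) :: real^'n)"
  have lin: "linear T" "linear T'"
    unfolding T_def T'_def
    by (auto intro!: linearI simp: vec_eq_iff inner_add_left scaleR_add_left sum.distrib scaleR_sum_right)
  have Tb: "T y \<bullet> b' (\<sigma> j) = y $ j" for y j
  proof -
    have "T y \<bullet> b' (\<sigma> j) = (\<Sum>i\<in>UNIV. if i = j then y $ j else 0)"
      unfolding T_def inner_sum_left by (intro sum.cong) (auto simp: b' \<sigma>n \<sigma>inj)
    then show ?thesis by simp
  qed
  have T'T: "T' (T y) = y" for y
    by (simp add: T'_def Tb vec_eq_iff)
  have TT': "T (T' z) = z" for z
  proof -
    have "T' \<circ> T = id" by (auto simp: T'T)
    then have "T \<circ> T' = id" using lin by (simp add: linear_inverse_left)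
    then show ?thesis by (metis comp_apply id_apply)
  qed
  have iso: "T x \<bullet> T y = x \<bullet> y" for x y
  proof -
    have "T x \<bullet> T y = (\<Sum>i\<in>UNIV. y $ i * (T x \<bullet> b' (\<sigma> i)))"
      by (subst (2) T_def) (simp add: inner_sum_right)
    also have "\<dots> = x \<bullet> y"
      by (simp only: Tb) (simp add: inner_vec_def mult.commute)
    finally show ?thesis .
  qed
  have Q: "compact ?Q"
    using S by (intro compact_continuous_image compact_Times) (auto intro!: continuous_intros simp: split_beta)
  define R where "R = T' ` (\<lambda>x. x - a) ` ?Q"
  have R: "compact R"
    unfolding R_def
    by (intro compact_image_linear lin compact_continuous_image Q continuous_intros)
  have TR: "T ` R = (\<lambda>x. x - a) ` ?Q"
    by (simp add: R_def image_image TT')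
  let ?N = "\<Pi>\<^sub>M i\<in>{..<Suc k}. (lborel :: real measure)" and ?V = "\<lambda>x. (\<chi> i. x (\<sigma> i)) :: real^'n"
  let ?A = "{z \<in> space ?N. (\<Sum>j<Suc k. z j *\<^sub>R b' j) + a \<in> ?Q}"
  have A: "?A \<in> sets ?N"
  proof -
    have "(\<lambda>z. (\<Sum>j<Suc k. z j *\<^sub>R b' j) + a) \<in> borel_measurable ?N"
      by measurable
    from measurable_sets[OF this borel_compact[OF Q]] show ?thesis
      by (simp add: vimage_def Int_def conj_commute)
  qed
  have S': "?S' \<in> sets ?M"
  proof -
    have "affine_param k a b \<in> borel_measurable ?M"
      unfolding affine_param_def by measurable
    from measurable_sets[OF this borel_compact[OF S]] show ?thesis
      by (simp add: vimage_def Int_def conj_commute space_PiM)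
  qed
  have "measure lebesgue ?Q = measure lebesgue ((\<lambda>x. x - a) ` ?Q)"
    proof -
    have "(\<lambda>x. x - a) ` ?Q = (+) (- a) ` ?Q"
      by (intro image_cong) auto
    then show ?thesis
      by (simp only: measure_translation)
  qed
  also have "\<dots> = measure lebesgue R"
    unfolding TR[symmetric] by (rule measure_isometry_image[OF lin(1) iso R])
  also have "\<dots> = measure (distr ?N borel ?V) R"
    using R by (simp add: distr_PiM_lborel_vec(1)[OF \<sigma>] measure_lborel_compact)
  also have "\<dots> = measure ?N (?V -` R \<inter> space ?N)"
    using R by (intro measure_distr distr_PiM_lborel_vec(2)[OF \<sigma>]) (simp add: borel_compact)
  also have "?V -` R \<inter> space ?N = ?A"
  proof -
    have "?V z \<in> R \<longleftrightarrow> (\<Sum>j<Suc k. z j *\<^sub>R b' j) + a \<in> ?Q" for z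
    proof -
      have TV: "T (?V z) = (\<Sum>j<Suc k. z j *\<^sub>R b' j)"
        unfolding T_def by (simp add: sum.reindex_bij_betw[OF \<sigma>, of "\<lambda>j. z j *\<^sub>R b' j"] del: sum.lessThan_Suc)
      have "?V z \<in> R \<longleftrightarrow> T (?V z) \<in> T ` R"
        using inj_image_mem_iff[of T "?V z" R] T'T by (metis injI)
      then show ?thesis
        unfolding TR TV mem_image_diff .
    qed
    then have "?V -` R = {z. (\<Sum>j<Suc k. z j *\<^sub>R b' j) + a \<in> ?Q}"
      by (simp only: vimage_def)
    then show ?thesis by (simp only: Int_def mem_Collect_eq conj_commute)
  qed
  also have "measure ?N ?A = measure ?M ?S'"
  proof -
    interpret product_sigma_finite "\<lambda>i::nat. lborel :: real measure"
      by standard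
    have "emeasure ?N ?A = (\<integral>\<^sup>+x. indicator ?A x \<partial>?N)"
      using A by simp
    also have "\<dots> = (\<integral>\<^sup>+x. (\<integral>\<^sup>+y. indicator ?A (x(k := y)) \<partial>lborel) \<partial>?M)"
      using A unfolding lessThan_Suc by (intro product_nn_integral_insert) auto
    also have "\<dots> = (\<integral>\<^sup>+x. (\<integral>\<^sup>+y. indicator ?S' x * indicator {0..1::real} y \<partial>lborel) \<partial>?M)"
    proof (intro nn_integral_cong)
      fix x and y :: real assume "x \<in> space ?M"
      then have x: "x \<in> {..<k} \<rightarrow>\<^sub>E UNIV" by (simp add: space_PiM)
      then have "x(k := y) \<in> space ?N"
        by (auto simp: space_PiM PiE_iff extensional_def)
      then have "x(k := y) \<in> ?A \<longleftrightarrow> affine_param k a b x + y *\<^sub>R w \<in> ?Q"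
        by (simp add: b'_def affine_param_def algebra_simps)
      also have "\<dots> \<longleftrightarrow> affine_param k a b x \<in> S \<and> y \<in> {0..1}" (is "?l \<longleftrightarrow> ?r")
      proof
        assume ?l
        then obtain s t where s: "s \<in> S" "t \<in> {0..1}" "affine_param k a b x + y *\<^sub>R w = s + t *\<^sub>R w"
          by auto
        obtain x' where x': "s = affine_param k a b x'"
          using s(1) sub by auto
        have "affine_param k a b z \<bullet> w = a \<bullet> w" for z
          by (simp add: affine_param_def inner_add_left inner_sum_left w(2))
        then have "y = t"
          using arg_cong[OF s(3), of "\<lambda>v. v \<bullet> w"] by (simp add: x' inner_add_left ww)
        then show ?r using s by auto
      qed force
      finally show "indicator ?A (x(k := y)) = (indicator ?S' x * indicator {0..1} y :: ennreal)"
        using x by (auto simp: indicator_def)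
    qed
    also have "\<dots> = (\<integral>\<^sup>+x. indicator ?S' x \<partial>?M)"
      by (simp add: nn_integral_cmult)
    also have "\<dots> = emeasure ?M ?S'"
      using S' by simp
    finally show ?thesis by (simp add: measure_def)
  qed
  finally show ?thesis ..
qed

text \<open>Prisms replace codimension-one volumes by volumes of full dimension, where linear maps act by a common
factor and no choice of a frame is involved.\<close>

definition prism :: "'a::euclidean_space set \<Rightarrow> 'a \<Rightarrow> 'a set" where
  "prism S u = (\<lambda>(s, t). s + t *\<^sub>R u) ` (S \<times> {0..1})"

lemma compact_prism: "compact S \<Longrightarrow> compact (prism S u)"
  unfolding prism_def
  by (intro compact_continuous_image compact_Times) (auto intro!: continuous_intros simp: split_beta)

lemma measure_prism_minus: "measure lebesgue (prism S (- u)) = measure lebesgue (prism S u)"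
proof -
  have "prism S (- u) = (+) (- u) ` prism S u"
  proof (intro set_eqI iffI)
    fix x assume "x \<in> prism S (- u)"
    then obtain s t where "s \<in> S" "t \<in> {0..1}" "x = s + t *\<^sub>R (- u)"
      by (auto simp: prism_def)
    then have "x = - u + (s + (1 - t) *\<^sub>R u)" "(s, 1 - t) \<in> S \<times> {0..1}"
      by (auto simp: algebra_simps)
    then show "x \<in> (+) (- u) ` prism S u"
      unfolding prism_def by (metis (no_types, lifting) image_eqI case_prod_conv)
  next
    fix x assume "x \<in> (+) (- u) ` prism S u"
    then obtain s t where "s \<in> S" "t \<in> {0..1}" "x = - u + (s + t *\<^sub>R u)"
      by (auto simp: prism_def)
    then have "x = s + (1 - t) *\<^sub>R (- u)" "(s, 1 - t) \<in> S \<times> {0..1}"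
      by (auto simp: algebra_simps)
    then show "x \<in> prism S (- u)"
      unfolding prism_def by (metis (no_types, lifting) image_eqI case_prod_conv)
  qed
  then show ?thesis by (simp only: measure_translation)
qed

lemma normal_of_subspace_unique:
  fixes u w :: "'a::real_inner"
  assumes "{x. u \<bullet> x = 0} \<subseteq> {x. w \<bullet> x = 0}" "norm u = 1"
  shows "w = (w \<bullet> u) *\<^sub>R u"
proof -
  define x where "x = w - (w \<bullet> u) *\<^sub>R u"
  have "u \<bullet> u = 1" using assms(2) by (simp add: norm_eq_1)
  then have ux: "u \<bullet> x = 0"
    by (simp add: x_def inner_diff_right inner_commute)
  then have "w \<bullet> x = 0" using assms(1) by auto
  then have "x \<bullet> x = 0"
    using ux by (simp add: x_def inner_diff_left inner_diff_right inner_commute)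
  then show ?thesis by (simp add: x_def)
qed

text \<open>This makes \<open>k_volume\<close> independent of the chosen frame: a frame whose subspace contains a spanning set of the
hyperplane has normal \<open>u\<close> or \<open>- u\<close>, and the prisms in both directions are translates of each other.\<close>

lemma k_volume_eq_prism:
  fixes S :: "(real^'n::finite) set"
  assumes S: "compact S" "0 \<in> S" and span: "span S = {x. u \<bullet> x = 0}" and u: "norm u = 1"
    and k: "CARD('n) = Suc k"
  shows "k_volume k S = measure lebesgue (prism S u)"
proof -
  have "u \<noteq> 0" using u by auto
  then have dim: "dim {x. u \<bullet> x = 0} = k"
    using k by (simp add: dim_hyperplane)
  obtain B where B: "B \<subseteq> {x. u \<bullet> x = 0}" "pairwise orthogonal B" "\<And>x. x \<in> B \<Longrightarrow> norm x = 1"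
     "independent B" "card B = dim {x. u \<bullet> x = 0}" "span B = {x. u \<bullet> x = 0}"
    using orthonormal_basis_subspace[OF subspace_hyperplane[of u]] by metis
  have "finite B" using B(4) independent_imp_finite by blast
  then obtain b where b: "bij_betw b {..<k} B"
    using B(5) dim by (metis card_lessThan finite_lessThan finite_same_card_bij)
  have frame: "affine_frame k 0 b"
    unfolding affine_frame_def
  proof (intro allI impI)
    fix i j assume ij: "i < k" "j < k"
    then have "b i \<in> B" "b j \<in> B" "b i = b j \<longleftrightarrow> i = j"
      using b by (auto simp: bij_betw_def inj_on_def)
    then show "b i \<bullet> b j = (if i = j then 1 else 0)"
      using B(2,3) by (auto simp: pairwise_def orthogonal_def norm_eq_1)
  qed
  have sub: "S \<subseteq> affine_param k 0 b ` ({..<k} \<rightarrow>\<^sub>E UNIV)"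
  proof
    fix x assume "x \<in> S"
    then have "x \<in> span B" using span B(6) span_base by blast
    then have "x = (\<Sum>v\<in>B. (x \<bullet> v) *\<^sub>R v)"
      using B(2,3) \<open>finite B\<close> by (simp add: orthonormal_basis_expand)
    also have "\<dots> = (\<Sum>i<k. (x \<bullet> b i) *\<^sub>R b i)"
      by (rule sum.reindex_bij_betw[OF b, symmetric])
    finally have "x = affine_param k 0 b (restrict (\<lambda>i. x \<bullet> b i) {..<k})"
      by (simp add: affine_param_def)
    then show "x \<in> affine_param k 0 b ` ({..<k} \<rightarrow>\<^sub>E UNIV)" by auto
  qed
  let ?vol = "\<lambda>a b. measure (\<Pi>\<^sub>M i\<in>{..<k}. lborel) {x \<in> {..<k} \<rightarrow>\<^sub>E UNIV. affine_param k a b x \<in> S}"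
  have prism: "?vol a b = measure lebesgue (prism S u)"
    if frame: "affine_frame k a b" and sub: "S \<subseteq> affine_param k a b ` ({..<k} \<rightarrow>\<^sub>E UNIV)" for a b
  proof -
    have "dim (b ` {..<k}) \<le> card (b ` {..<k})"
      by (intro dim_le_card') auto
    also have "\<dots> \<le> k" using card_image_le[of "{..<k}" b] by simp
    finally have "dim (b ` {..<k}) < DIM(real^'n)" using k by simp
    then obtain w0 where w0: "w0 \<noteq> 0" "span (b ` {..<k}) \<subseteq> {x. w0 \<bullet> x = 0}"
      using lowdim_subset_hyperplane by blast
    define w where "w = w0 /\<^sub>R norm w0"
    have w: "norm w = 1" using w0 by (simp add: w_def)
    have wb: "b i \<bullet> w = 0" if "i < k" for i
      using w0 that span_base[of "b i" "b ` {..<k}"] by (auto simp: w_def inner_commute)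
    have param: "affine_param k a b x \<bullet> w = a \<bullet> w" for x
      by (simp add: affine_param_def inner_add_left inner_sum_left wb)
    have aw: "s \<bullet> w = a \<bullet> w" if "s \<in> S" for s
      using sub that param by auto
    have "s \<bullet> w = 0" if "s \<in> S" for s
      using aw[OF that] aw[OF S(2)] by simp
    then have "span S \<subseteq> {x. w \<bullet> x = 0}"
      by (intro span_minimal subspace_hyperplane) (auto simp: inner_commute)
    then have *: "w = (w \<bullet> u) *\<^sub>R u"
      using span u by (intro normal_of_subspace_unique) auto
    then have "\<bar>w \<bullet> u\<bar> = 1"
      using w u by (metis mult.right_neutral norm_scaleR)
    then have "w = u \<or> w = - u"
      using * by (metis abs_1 abs_eq_iff scaleR_minus1_left scaleR_one)
    then have "measure lebesgue (prism S w) = measure lebesgue (prism S u)"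
      by (auto simp: measure_prism_minus)
    then show ?thesis
      using frame_measure_eq_prism[OF S(1) frame k sub w wb] by (simp add: prism_def)
  qed
  show ?thesis
    unfolding k_volume_def
  proof (rule some_equality)
    show "\<exists>a b. affine_frame k a b \<and> S \<subseteq> affine_param k a b ` ({..<k} \<rightarrow>\<^sub>E UNIV) \<and>
      measure lebesgue (prism S u) = ?vol a b"
      using frame sub prism[OF frame sub]
      by (intro exI[of _ 0] exI[of _ b] conjI) simp_all
  qed (auto simp: prism)
qed

text \<open>Simplex and prism over the same base with the same last edge are images of one standard simplex and one
standard prism under a common linear map. So the ratio of their volumes is a universal constant, which cancels in the
normalised vector \<open>m\<close>.\<close>

lemma simplex_volume_eq_prism:
  "\<exists>\<kappa>>0. \<forall>(B :: (real^'n::finite) set) u. finite B \<and> Suc (card B) = CARD('n) \<longrightarrow>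
     measure lebesgue (convex hull (insert 0 (insert u B))) =
       \<kappa> * measure lebesgue (prism (convex hull (insert 0 B)) u)"
proof -
  obtain j0 :: 'n where True by simp
  define A :: "(real^'n) set" where "A = (\<lambda>j. axis j 1) ` (UNIV - {j0})"
  define std where "std = convex hull (insert 0 (insert (axis j0 1) A))"
  define Q where "Q = prism (convex hull (insert 0 A)) (axis j0 1)"
  have Basis: "insert (axis j0 1) A = Basis"
    by (auto simp: A_def Basis_vec_def)
  have std: "measure lebesgue std > 0"
    using content_std_simplex[where 'a = "real^'n"]
    by (simp add: std_def Basis measure_lborel_compact finite_imp_compact_convex_hull)
  have cpt: "compact std" "compact Q"
    unfolding std_def Q_def Basis
    by (auto intro!: compact_prism finite_imp_compact_convex_hull simp: A_def)
  have "convex Q"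
  proof -
    have "Q = (\<lambda>(s, t). s + t *\<^sub>R axis j0 1) ` ((convex hull (insert 0 A)) \<times> {0..1})"
      by (simp add: Q_def prism_def)
    also have "convex \<dots>"
      by (intro convex_linear_image linearI convex_Times) (auto simp: algebra_simps)
    finally show ?thesis .
  qed
  moreover have "insert 0 (insert (axis j0 1) A) \<subseteq> Q"
  proof -
    have "convex hull (insert 0 A) \<subseteq> Q"
      unfolding Q_def prism_def by (force intro!: image_eqI[where x = "(s, 0)" for s])
    moreover have "axis j0 1 \<in> Q"
      unfolding Q_def prism_def by (intro image_eqI[where x = "(0, 1)"]) (auto intro: hull_inc)
    ultimately show ?thesis using hull_subset[of "insert 0 A" convex] by auto
  qed
  ultimately have "std \<subseteq> Q"
    unfolding std_def by (rule hull_minimal[rotated])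
  then have Q: "measure lebesgue Q > 0"
    using std measure_mono_fmeasurable[of std Q lebesgue] cpt
    by (metis lmeasurable_compact fmeasurableD less_le_trans)
  show ?thesis
  proof (intro exI[of _ "measure lebesgue std / measure lebesgue Q"] conjI allI impI)
    show "0 < measure lebesgue std / measure lebesgue Q" using std Q by simp
    fix B :: "(real^'n) set" and u assume B: "finite B \<and> Suc (card B) = CARD('n)"
    then have "card (UNIV - {j0}) = card B"
      by (metis card_Diff_singleton UNIV_I diff_Suc_1)
    then obtain f where f: "bij_betw f (UNIV - {j0}) B"
      using B by (metis finite finite_same_card_bij)
    define L where "L = (\<lambda>x::real^'n. \<Sum>j\<in>UNIV. x $ j *\<^sub>R (if j = j0 then u else f j))"
    have lin: "linear L"
      by (rule linearI) (auto simp: L_def scaleR_add_left sum.distrib scaleR_sum_right)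
    have L: "L (axis j 1) = (if j = j0 then u else f j)" for j
      unfolding L_def by (subst sum.remove[of _ j]) (auto simp: axis_def intro!: sum.neutral)
    have LA: "L ` A = B"
    proof -
      have "L ` A = f ` (UNIV - {j0})"
        unfolding A_def image_image by (intro image_cong) (auto simp: L)
      then show ?thesis using f by (simp add: bij_betw_def)
    qed
    have L0: "L 0 = 0" using lin by (simp add: linear_0)
    obtain c where c: "\<And>S. compact S \<Longrightarrow> measure lebesgue (L ` S) = c * measure lebesgue S"
      using linear_image_scales_measure[OF lin] by blast
    have "L ` std = convex hull (insert 0 (insert u B))"
      using lin by (simp add: std_def convex_hull_linear_image LA L L0)
    moreover have "L ` Q = prism (convex hull (insert 0 B)) u"
    proof -
      have "L ` Q = (\<lambda>(s, t). L s + t *\<^sub>R u) ` ((convex hull (insert 0 A)) \<times> {0..1})"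
        unfolding Q_def prism_def image_image
        by (intro image_cong) (auto simp: linear_add[OF lin] linear_scale[OF lin] L)
      also have "\<dots> = prism (L ` (convex hull (insert 0 A))) u"
        unfolding prism_def by force
      also have "L ` (convex hull (insert 0 A)) = convex hull (insert 0 B)"
        using lin by (simp add: convex_hull_linear_image LA L0)
      finally show ?thesis .
    qed
    ultimately show "measure lebesgue (convex hull (insert 0 (insert u B))) =
       measure lebesgue std / measure lebesgue Q * measure lebesgue (prism (convex hull (insert 0 B)) u)"
      using c[OF cpt(1)] c[OF cpt(2)] Q by simp
  qed
qed

text \<open>Base times height: for the apex \<open>u\<close> this is the comparison of simplex and prism, and moving the apex from
\<open>u\<close> to \<open>p\<close> scales the volume by \<open>u \<bullet> p\<close>.\<close>

lemma simplex_volume_eq_k_volume: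
  obtains \<kappa> where "\<kappa> > 0"
    "\<And>(B :: (real^'n::finite) set) u p. \<lbrakk>independent B; Suc (card B) = CARD('n); norm u = 1;
       \<And>v. v \<in> B \<Longrightarrow> u \<bullet> v = 0; u \<bullet> p > 0\<rbrakk> \<Longrightarrow>
     measure lebesgue (convex hull (insert p (insert 0 B))) =
       \<kappa> * ((u \<bullet> p) * k_volume (CARD('n) - 1) (convex hull (insert 0 B)))"
proof -
  obtain \<kappa> where \<kappa>: "\<kappa> > 0" "\<And>(B :: (real^'n) set) u. finite B \<Longrightarrow> Suc (card B) = CARD('n) \<Longrightarrow>
     measure lebesgue (convex hull (insert 0 (insert u B))) =
       \<kappa> * measure lebesgue (prism (convex hull (insert 0 B)) u)"
    using simplex_volume_eq_prism by blast
  show thesis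
  proof (rule that[OF \<kappa>(1)])
    fix B :: "(real^'n) set" and u p
    assume B: "independent B" "Suc (card B) = CARD('n)" and u: "norm u = 1"
      and uB: "\<And>v. v \<in> B \<Longrightarrow> u \<bullet> v = 0" and up: "u \<bullet> p > 0"
    have fin: "finite B" using B(1) independent_imp_finite by blast
    have "0 \<notin> B" using B(1) dependent_zero by blast
    have uu: "u \<bullet> u = 1" using u by (simp add: norm_eq_1)
    have span_sub: "span B \<subseteq> {x. u \<bullet> x = 0}"
      using uB by (intro span_minimal subspace_hyperplane) auto
    then have "u \<notin> span B" using uu by auto
    have "u \<notin> B" "u \<noteq> 0" using uB uu by auto
    have "dim {x. u \<bullet> x = 0} = dim B"
      using B \<open>u \<noteq> 0\<close> dim_eq_card_independent[OF B(1)] by (simp add: dim_hyperplane)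
    then have span: "span B = {x. u \<bullet> x = 0}"
      by (intro subspace_dim_equal subspace_hyperplane span_sub) auto
    have "span (convex hull (insert 0 B)) = {x. u \<bullet> x = 0}"
    proof
      show "span (convex hull (insert 0 B)) \<subseteq> {x. u \<bullet> x = 0}"
        using uB by (intro span_minimal subspace_hyperplane hull_minimal subspace_imp_convex) auto
      show "{x. u \<bullet> x = 0} \<subseteq> span (convex hull (insert 0 B))"
        unfolding span[symmetric] by (intro span_mono) (auto intro: hull_inc)
    qed
    then have "k_volume (CARD('n) - 1) (convex hull (insert 0 B)) =
        measure lebesgue (prism (convex hull (insert 0 B)) u)"
      using fin u B(2) by (intro k_volume_eq_prism) (auto intro: hull_inc finite_imp_compact_convex_hull)
    then have 1: "measure lebesgue (convex hull (insert 0 (insert u B))) =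
        \<kappa> * k_volume (CARD('n) - 1) (convex hull (insert 0 B))"
      using \<kappa>(2)[OF fin B(2)] by simp
    define X where "X = insert u (insert 0 B)"
    have X: "X - {u} = insert 0 B" "card X = Suc CARD('n)"
      using \<open>u \<notin> B\<close> \<open>u \<noteq> 0\<close> \<open>0 \<notin> B\<close> fin B(2) by (auto simp: X_def)
    have "independent (insert u B)"
      using B(1) \<open>u \<notin> span B\<close> by (simp add: independent_insert)
    then have "span (insert u B) = UNIV"
      using B(2) fin \<open>u \<notin> B\<close> 
      by (metis DIM_cart DIM_real card_insert_disjoint dim_eq_card_independent dim_eq_full mult.right_neutral)
    then have "affine hull X = UNIV"
      by (simp add: X_def insert_commute[of u 0] affine_hull_span_0 hull_inc span_insert_0)
    then have "measure lebesgue (convex hull (insert p (X - {u}))) = \<bar>u \<bullet> p + 0\<bar> * measure lebesgue (convex hull X)"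
      by (intro simplex_volume_move_vertex X) (use uB uu in \<open>auto simp: X_def\<close>)
    then have "measure lebesgue (convex hull (insert p (insert 0 B))) = (u \<bullet> p) * measure lebesgue (convex hull X)"
      using X(1) up by simp
    then show "measure lebesgue (convex hull (insert p (insert 0 B))) =
       \<kappa> * ((u \<bullet> p) * k_volume (CARD('n) - 1) (convex hull (insert 0 B)))"
      using 1 by (simp add: X_def insert_commute)
  qed
qed

section \<open>Simplices with a common apex\<close>

text \<open>The gradient of the barycentric coordinate of \<open>p\<close> in the simplex with apex \<open>c\<close> and base \<open>B\<close>. The value zero for
points outside \<open>B\<close> lets sums run over all simplices of a complex.\<close>

definition dual_vector :: "'a::euclidean_space \<Rightarrow> 'a set \<Rightarrow> 'a \<Rightarrow> 'a" where
  "dual_vector c B p =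
     (if p \<in> B then SOME e. \<forall>v\<in>B. e \<bullet> (v - c) = (if v = p then 1 else 0) else 0)"

lemma dual_vector_outside [simp]: "p \<notin> B \<Longrightarrow> dual_vector c B p = 0"
  by (simp add: dual_vector_def)

lemma dual_vector_inner:
  assumes "\<not> affine_dependent (insert c B)" "c \<notin> B" "v \<in> B"
  shows "dual_vector c B p \<bullet> (v - c) = (if v = p then 1 else 0)"
proof (cases "p \<in> B")
  case True
  have "\<exists>e. \<forall>v\<in>B. e \<bullet> (v - c) = (if v = p then 1 else 0)"
  proof -
    let ?B = "(\<lambda>x. - c + x) ` B"
    have "independent ?B"
      using assms by (simp add: affine_dependent_iff_dependent)
    then obtain g :: "'a \<Rightarrow> real" where g: "linear g" "\<forall>x\<in>?B. g x = (if x = p - c then 1 else 0)"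
      using linear_independent_extend[of ?B "\<lambda>x. if x = p - c then 1 else 0 :: real"] by blast
    define e where "e = adjoint g 1"
    have "e \<bullet> x = g x" for x
      using adjoint_works[OF g(1), of x 1] by (simp add: e_def inner_commute)
    then show ?thesis
      using g(2) by (intro exI[of _ e]) (auto simp del: minus_add_distrib)
  qed
  from someI_ex[OF this] show ?thesis
    using True assms(3) by (simp add: dual_vector_def)
qed (use assms(3) in auto)

definition move_vertex :: "'a::euclidean_space \<Rightarrow> 'a \<Rightarrow> 'a set \<Rightarrow> 'a set" where
  "move_vertex p q B = (if p \<in> B then insert q (B - {p}) else B)"

text \<open>The map considered here is affine; with \<open>w = q - p\<close> and a dual vector for \<open>e\<close> it fixes the apex and all vertices but
\<open>p\<close>, and sends \<open>p\<close> to \<open>q\<close>.\<close>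

lemma convex_hull_shear_image:
  fixes e w c :: "'a::euclidean_space"
  defines "A \<equiv> \<lambda>x. x + (e \<bullet> (x - c)) *\<^sub>R w"
  shows "A ` (convex hull S) = convex hull (A ` S)"
proof -
  define T where "T = (\<lambda>x. x + (e \<bullet> x) *\<^sub>R w)"
  have lin: "linear T"
    by (rule linearI) (auto simp: T_def algebra_simps)
  have A: "A = (\<lambda>x. - (e \<bullet> c) *\<^sub>R w + x) \<circ> T"
    by (auto simp: A_def T_def fun_eq_iff algebra_simps)
  show ?thesis
    unfolding A image_comp[symmetric]
    by (simp only: convex_hull_translation convex_hull_linear_image[OF lin])
qed

text \<open>The cone over a triangulated boundary, as seen from an inner point \<open>c\<close>. A boundary simplex is represented by its
set of vertices because the vertices are going to be moved.\<close>

locale coned_complex =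
  fixes P :: "(real^'n::finite) set" and c :: "real^'n" and K :: "(real^'n) set set"
  assumes finite_K: "finite K"
    and card_K: "\<And>B. B \<in> K \<Longrightarrow> card B = CARD('n)"
    and apex_notin: "\<And>B. B \<in> K \<Longrightarrow> c \<notin> B"
    and indep: "\<And>B. B \<in> K \<Longrightarrow> \<not> affine_dependent (insert c B)"
    and convex_P: "convex P"
    and cover: "P = (\<Union>B\<in>K. convex hull (insert c B))"
    and meet: "\<And>B B'. B \<in> K \<Longrightarrow> B' \<in> K \<Longrightarrow>
      (convex hull (insert c B)) \<inter> (convex hull (insert c B')) \<subseteq> convex hull (insert c (B \<inter> B'))"
begin

abbreviation cone_volume :: "(real^'n) set \<Rightarrow> real" where
  "cone_volume B \<equiv> measure lebesgue (convex hull (insert c B))"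

abbreviation dual :: "(real^'n) set \<Rightarrow> real^'n \<Rightarrow> real^'n" where
  "dual \<equiv> dual_vector c"

text \<open>The derivative at \<open>p\<close> of the total volume of the cones with respect to the position of \<open>p\<close>.\<close>

definition gradient :: "real^'n \<Rightarrow> real^'n" where
  "gradient p = (\<Sum>B\<in>K. cone_volume B *\<^sub>R dual B p)"

lemma finite_B: "B \<in> K \<Longrightarrow> finite B"
  using card_K card.infinite by fastforce

lemma dual_inner: "B \<in> K \<Longrightarrow> v \<in> B \<Longrightarrow> dual B p \<bullet> (v - c) = (if v = p then 1 else 0)"
  by (intro dual_vector_inner indep apex_notin)

lemma card_insert_apex: "B \<in> K \<Longrightarrow> card (insert c B) = Suc CARD('n)"
  by (simp add: finite_B apex_notin card_K)

lemma affine_hull_cone: "B \<in> K \<Longrightarrow> affine hull (insert c B) = UNIV"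
  using affine_independent_span_eq[OF indep] card_insert_apex by simp

lemma compact_cone: "B \<in> K \<Longrightarrow> compact (convex hull (insert c B))"
  by (simp add: finite_B finite_imp_compact_convex_hull)

lemma cone_volume_pos:
  assumes "B \<in> K" shows "cone_volume B > 0"
proof -
  have "interior (convex hull (insert c B)) \<noteq> {}"
    using affine_hull_cone[OF assms] by (metis affine_hull_convex_hull affine_hull_UNIV
      rel_interior_eq_empty convex_convex_hull rel_interior_interior convex_hull_eq_empty insert_not_empty)
  then have "\<not> negligible (convex hull (insert c B))"
    by (simp add: negligible_convex_interior)
  then show ?thesis
    using compact_cone[OF assms] lmeasurable_compact
    by (metis measure_nonneg less_eq_real_def negligible_iff_measure)
qed

lemma dual_coordinates:
  assumes B: "B \<in> K"
  shows "x - c = (\<Sum>v\<in>B. (dual B v \<bullet> (x - c)) *\<^sub>R (v - c))"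
proof -
  have "x \<in> affine hull (insert c B)"
    using affine_hull_cone[OF B] by simp
  then obtain y where y: "x = c + y" "y \<in> span ((\<lambda>v. - c + v) ` B)"
    using affine_hull_insert_span_gen[of c B] by auto
  have "y = (\<Sum>v\<in>B. (dual B v \<bullet> y) *\<^sub>R (v - c))"
    using y(2)
  proof (induction rule: span_induct_alt)
    case base
    show ?case by simp
  next
    case (step r z y)
    obtain v where v: "v \<in> B" "z = v - c" using step(1) by auto
    have "(\<Sum>u\<in>B. (dual B u \<bullet> z) *\<^sub>R (u - c)) = (\<Sum>u\<in>B. if u = v then z else 0)"
      using v by (intro sum.cong) (auto simp: dual_inner[OF B])
    also have "\<dots> = z" using v finite_B[OF B] by simp
    finally have z: "(\<Sum>u\<in>B. (dual B u \<bullet> z) *\<^sub>R (u - c)) = z" .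
    have "(\<Sum>u\<in>B. (dual B u \<bullet> (r *\<^sub>R z + y)) *\<^sub>R (u - c)) =
        r *\<^sub>R (\<Sum>u\<in>B. (dual B u \<bullet> z) *\<^sub>R (u - c)) + (\<Sum>u\<in>B. (dual B u \<bullet> y) *\<^sub>R (u - c))"
      by (simp add: inner_add_right scaleR_add_left sum.distrib scaleR_sum_right)
    then show ?case using z step(2) by simp
  qed
  then show ?thesis using y(1) by simp
qed

text \<open>The barycentric coordinate of \<open>p\<close>, glued from all cones. Points lying in several cones lie over common vertices, so the
choice of the cone is immaterial (\<open>hat_eq\<close>).\<close>

definition hat :: "real^'n \<Rightarrow> real^'n \<Rightarrow> real" where
  "hat p x = dual (SOME B. B \<in> K \<and> x \<in> convex hull (insert c B)) p \<bullet> (x - c)"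

lemma hat_eq:
  assumes B: "B \<in> K" and x: "x \<in> convex hull (insert c B)"
  shows "hat p x = dual B p \<bullet> (x - c)"
proof -
  define B' where "B' = (SOME B. B \<in> K \<and> x \<in> convex hull (insert c B))"
  have B': "B' \<in> K" "x \<in> convex hull (insert c B')"
    using someI[of "\<lambda>B. B \<in> K \<and> x \<in> convex hull (insert c B)" B] assms by (auto simp: B'_def)
  have "convex hull (insert c (B \<inter> B')) \<subseteq> {y. (dual B p - dual B' p) \<bullet> y = (dual B p - dual B' p) \<bullet> c}"
  proof (intro hull_minimal convex_hyperplane subsetI)
    fix v assume "v \<in> insert c (B \<inter> B')"
    then show "v \<in> {y. (dual B p - dual B' p) \<bullet> y = (dual B p - dual B' p) \<bullet> c}"
      using dual_inner[OF B, of v p] dual_inner[OF B'(1), of v p] by (auto simp: inner_diff_left inner_diff_right)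
  qed
  then show ?thesis
    using meet[OF B B'(1)] x B'(2) unfolding hat_def B'_def[symmetric]
    by (auto simp: inner_diff_left inner_diff_right)
qed

text \<open>A crude common Lipschitz constant for all the linear pieces of the hat function of \<open>p\<close>.\<close>

definition hat_slope :: "real^'n \<Rightarrow> real" where
  "hat_slope p = (\<Sum>B\<in>K. norm (dual B p))"

lemma hat_slope_nonneg: "hat_slope p \<ge> 0"
  by (simp add: hat_slope_def sum_nonneg)

lemma norm_dual_le_hat_slope: "B \<in> K \<Longrightarrow> norm (dual B p) \<le> hat_slope p"
  unfolding hat_slope_def by (rule member_le_sum) (auto simp: finite_K)

text \<open>On the segment between two points of the convex set \<open>P\<close>, the hat function is continuous and linear on finitely many
closed pieces, so the bound for the pieces is a bound for the whole segment.\<close>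

lemma hat_lipschitz:
  assumes x: "x \<in> P" and y: "y \<in> P"
  shows "\<bar>hat p y - hat p x\<bar> \<le> hat_slope p * norm (y - x)"
proof -
  define g where "g = (\<lambda>t::real. x + t *\<^sub>R (y - x))"
  define U where "U = (\<lambda>B. {0..1} \<inter> g -` (convex hull (insert c B)))"
  let ?M = "hat_slope p * norm (y - x)"
  have "lipschitz_on ?M {0..1} (\<lambda>t. hat p (g t))"
  proof (rule lipschitz_on_closed_Union)
    show "lipschitz_on ?M (U B) (\<lambda>t. hat p (g t))" if B: "B \<in> K" for B
    proof (rule lipschitz_onI)
      fix s t assume "s \<in> U B" "t \<in> U B"
      then have "hat p (g s) - hat p (g t) = dual B p \<bullet> (g s - g t)"
        using B by (simp add: U_def hat_eq inner_diff_right)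
      also have "\<dots> = (s - t) * (dual B p \<bullet> (y - x))"
        by (simp add: g_def algebra_simps)
      also have "\<bar>\<dots>\<bar> \<le> \<bar>s - t\<bar> * (norm (dual B p) * norm (y - x))"
        unfolding abs_mult by (intro mult_left_mono Cauchy_Schwarz_ineq2) auto
      also have "\<dots> \<le> \<bar>s - t\<bar> * ?M"
        by (intro mult_left_mono mult_right_mono norm_dual_le_hat_slope B) auto
      finally show "dist (hat p (g s)) (hat p (g t)) \<le> ?M * dist s t"
        by (simp add: dist_real_def mult.commute)
    qed (simp add: hat_slope_nonneg)
    show "closed (U B)" if "B \<in> K" for B
      unfolding U_def g_def
      by (intro continuous_closed_preimage continuous_intros closed_atLeastAtMost compact_imp_closed compact_cone that)
    show "{0..1} \<subseteq> (\<Union>B\<in>K. U B)"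
    proof
      fix t :: real assume t: "t \<in> {0..1}"
      then have "g t \<in> P"
        using convexD_alt[OF convex_P x y, of t] by (simp add: g_def algebra_simps)
      then show "t \<in> (\<Union>B\<in>K. U B)" using t cover by (auto simp: U_def)
    qed
  qed (use finite_K hat_slope_nonneg in auto)
  from lipschitz_onD[OF this, of 1 0] show ?thesis
    by (simp add: g_def dist_real_def)
qed

definition perturb :: "real^'n \<Rightarrow> real^'n \<Rightarrow> real^'n \<Rightarrow> real^'n" where
  "perturb p q x = x + hat p x *\<^sub>R (q - p)"

lemma perturb_eq:
  "B \<in> K \<Longrightarrow> x \<in> convex hull (insert c B) \<Longrightarrow> perturb p q x = x + (dual B p \<bullet> (x - c)) *\<^sub>R (q - p)"
  by (simp add: perturb_def hat_eq)

text \<open>A perturbation of the identity by a map with Lipschitz constant below one is injective.\<close>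

lemma inj_on_perturb:
  assumes "hat_slope p * norm (q - p) < 1"
  shows "inj_on (perturb p q) P"
proof (rule inj_onI)
  fix x y assume xy: "x \<in> P" "y \<in> P" "perturb p q x = perturb p q y"
  then have "y - x = (hat p x - hat p y) *\<^sub>R (q - p)"
    by (simp add: perturb_def algebra_simps)
  then have "norm (y - x) = \<bar>hat p x - hat p y\<bar> * norm (q - p)"
    by simp
  also have "\<dots> \<le> (hat_slope p * norm (y - x)) * norm (q - p)"
    using hat_lipschitz[OF xy(1,2), of p] by (intro mult_right_mono) auto
  finally have "norm (y - x) * (1 - hat_slope p * norm (q - p)) \<le> 0"
    by (simp add: algebra_simps)
  then show "x = y"
    using assms by (simp add: mult_le_0_iff)
qed

lemma shear_vertices:
  assumes B: "B \<in> K"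
  shows "(\<lambda>x. x + (dual B p \<bullet> (x - c)) *\<^sub>R (q - p)) ` insert c B = insert c (move_vertex p q B)"
proof -
  have "(\<lambda>x. x + (dual B p \<bullet> (x - c)) *\<^sub>R (q - p)) ` B = (\<lambda>x. if x = p then q else x) ` B"
    by (intro image_cong) (auto simp: dual_inner[OF B])
  also have "\<dots> = move_vertex p q B"
    by (auto simp: move_vertex_def)
  finally show ?thesis by simp
qed

lemma perturb_cone:
  assumes B: "B \<in> K"
  shows "perturb p q ` (convex hull (insert c B)) = convex hull (insert c (move_vertex p q B))"
proof -
  have "perturb p q ` (convex hull (insert c B)) =
      (\<lambda>x. x + (dual B p \<bullet> (x - c)) *\<^sub>R (q - p)) ` (convex hull (insert c B))"
    by (intro image_cong refl perturb_eq B)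
  then show ?thesis
    by (simp only: convex_hull_shear_image shear_vertices[OF B])
qed

text \<open>By injectivity an overlap of moved cones is the image of an overlap of the original ones, which lies over
the common vertices and so has smaller dimension.\<close>

lemma moved_cones_overlap_negligible:
  assumes "hat_slope p * norm (q - p) < 1" and B: "B \<in> K" "B' \<in> K" "B \<noteq> B'"
  shows "negligible (convex hull (insert c (move_vertex p q B)) \<inter> convex hull (insert c (move_vertex p q B')))"
proof -
  let ?A = "\<lambda>x. x + (dual B p \<bullet> (x - c)) *\<^sub>R (q - p)"
  have sub: "convex hull (insert c B) \<subseteq> P" "convex hull (insert c B') \<subseteq> P"
    using B cover by auto
  have "convex hull (insert c (move_vertex p q B)) \<inter> convex hull (insert c (move_vertex p q B')) =
      perturb p q ` (convex hull (insert c B) \<inter> convex hull (insert c B'))"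
    using inj_on_image_Int[OF inj_on_perturb[OF assms(1)] sub] by (simp add: perturb_cone B)
  also have "\<dots> \<subseteq> perturb p q ` (convex hull (insert c (B \<inter> B')))"
    by (intro image_mono meet B)
  also have "\<dots> = ?A ` (convex hull (insert c (B \<inter> B')))"
  proof (intro image_cong refl perturb_eq B)
    show "x \<in> convex hull (insert c B)" if "x \<in> convex hull (insert c (B \<inter> B'))" for x
      using that hull_mono[of "insert c (B \<inter> B')" "insert c B" convex] by auto
  qed
  also have "\<dots> = convex hull (?A ` insert c (B \<inter> B'))"
    by (rule convex_hull_shear_image)
  finally have *: "convex hull (insert c (move_vertex p q B)) \<inter> convex hull (insert c (move_vertex p q B'))
      \<subseteq> convex hull (?A ` insert c (B \<inter> B'))" .
  have "B \<inter> B' \<noteq> B"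
    using B card_K by (metis card_subset_eq finite_B inf_le2)
  then have "card (B \<inter> B') < CARD('n)"
    using card_K[OF B(1)] finite_B[OF B(1)] by (metis inf_le1 psubsetI psubset_card_mono)
  then have "card (insert c (B \<inter> B')) \<le> CARD('n)"
    using finite_B[OF B(1)] by (simp add: card_insert_if)
  then have "card (?A ` insert c (B \<inter> B')) \<le> CARD('n)"
    using card_image_le[of "insert c (B \<inter> B')" ?A] finite_B[OF B(1)] by simp
  then have "negligible (convex hull (?A ` insert c (B \<inter> B')))"
    using finite_B[OF B(1)] by (intro negligible_convex_hull_card) auto
  then show ?thesis
    using * by (rule negligible_subset)
qed

text \<open>The factor is the value at \<open>q\<close> of the barycentric coordinate of \<open>p\<close>; smallness of the displacement keeps it
positive, so that the volume is affine in \<open>q\<close>.\<close>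

lemma move_vertex_cone_volume:
  assumes "hat_slope p * norm (q - p) < 1" and B: "B \<in> K"
  shows "measure lebesgue (convex hull (insert c (move_vertex p q B))) =
    cone_volume B * (1 + dual B p \<bullet> (q - p))"
proof (cases "p \<in> B")
  case True
  let ?e = "dual B p"
  have pc: "p \<noteq> c" using True apex_notin[OF B] by auto
  have e1: "?e \<bullet> (p - c) = 1" using dual_inner[OF B True] by simp
  have "measure lebesgue (convex hull (insert q (insert c B - {p}))) = \<bar>?e \<bullet> q + (- (?e \<bullet> c))\<bar> * cone_volume B"
    by (rule simplex_volume_move_vertex[OF card_insert_apex affine_hull_cone])
      (use B True e1 in \<open>auto simp: inner_diff_right algebra_simps dest: dual_inner[of B _ p]\<close>)
  moreover have "insert q (insert c B - {p}) = insert c (move_vertex p q B)"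
    using True pc by (auto simp: move_vertex_def)
  moreover have "?e \<bullet> q + (- (?e \<bullet> c)) = 1 + ?e \<bullet> (q - p)"
    using e1 by (simp add: inner_diff_right)
  moreover have "\<bar>?e \<bullet> (q - p)\<bar> < 1"
  proof -
    have "\<bar>?e \<bullet> (q - p)\<bar> \<le> norm ?e * norm (q - p)"
      by (rule Cauchy_Schwarz_ineq2)
    also have "\<dots> \<le> hat_slope p * norm (q - p)"
      by (intro mult_right_mono norm_dual_le_hat_slope B) auto
    finally show ?thesis using assms(1) by simp
  qed
  ultimately show ?thesis by (simp add: mult.commute)
qed (simp add: move_vertex_def)

lemma compact_moved_cone: "B \<in> K \<Longrightarrow> compact (convex hull (insert c (move_vertex p q B)))"
  by (simp add: finite_B finite_imp_compact_convex_hull move_vertex_def)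

text \<open>The tiling of \<open>P\<close> itself is the case of a displacement of length zero.\<close>

lemma measure_P: "measure lebesgue P = (\<Sum>B\<in>K. cone_volume B)"
proof -
  have mv: "move_vertex c c B = B" for B by (auto simp: move_vertex_def)
  have small: "hat_slope c * norm (c - c) < 1" by simp
  show ?thesis
    using moved_cones_overlap_negligible[OF small] unfolding mv
    by (subst cover, intro measure_negligible_finite_Union_image finite_K)
      (auto simp: pairwise_def compact_cone lmeasurable_compact)
qed

lemma moved_volume:
  assumes small: "hat_slope p * norm (q - p) < 1"
  shows "measure lebesgue (\<Union>B\<in>K. convex hull (insert c (move_vertex p q B))) =
    measure lebesgue P + gradient p \<bullet> (q - p)"
proof -
  have "measure lebesgue (\<Union>B\<in>K. convex hull (insert c (move_vertex p q B))) =
      (\<Sum>B\<in>K. measure lebesgue (convex hull (insert c (move_vertex p q B))))"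
    using moved_cones_overlap_negligible[OF small]
    by (intro measure_negligible_finite_Union_image finite_K)
      (auto simp: pairwise_def compact_moved_cone lmeasurable_compact)
  also have "\<dots> = (\<Sum>B\<in>K. cone_volume B * (1 + dual B p \<bullet> (q - p)))"
    by (simp add: move_vertex_cone_volume[OF small])
  also have "\<dots> = measure lebesgue P + gradient p \<bullet> (q - p)"
    by (simp add: measure_P gradient_def inner_sum_left distrib_left sum.distrib)
  finally show ?thesis .
qed

lemma moved_cone_subset:
  assumes W: "convex W" "c \<in> W" "q \<in> W" "\<Union>K - {p} \<subseteq> W" and B: "B \<in> K"
  shows "convex hull (insert c (move_vertex p q B)) \<subseteq> W"
  using assms by (intro hull_minimal) (auto simp: move_vertex_def)

text \<open>The moved tiling lies in every convex set that contains its vertices. This is applied to the hull of \<open>q\<close> and the vertices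
other than \<open>p\<close>.\<close>

lemma volume_lower_bound:
  assumes W: "convex W" "W \<in> lmeasurable" "c \<in> W" "q \<in> W" "\<Union>K - {p} \<subseteq> W"
    and small: "hat_slope p * norm (q - p) < 1"
  shows "measure lebesgue P + gradient p \<bullet> (q - p) \<le> measure lebesgue W"
  unfolding moved_volume[OF small, symmetric]
proof (rule measure_mono_fmeasurable)
  show "(\<Union>B\<in>K. convex hull (insert c (move_vertex p q B))) \<subseteq> W"
    using moved_cone_subset[OF W(1,3,4,5)] by blast
  show "(\<Union>B\<in>K. convex hull (insert c (move_vertex p q B))) \<in> sets lebesgue"
    by (intro fmeasurableD lmeasurable_compact compact_UN finite_K compact_moved_cone)
qed fact

text \<open>The cone with apex \<open>c\<close> generated by the base \<open>B\<close>, described by nonnegative coordinates.\<close>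

definition infinite_cone :: "(real^'n) set \<Rightarrow> (real^'n) set" where
  "infinite_cone B = {x. \<forall>v\<in>B. dual B v \<bullet> (x - c) \<ge> 0}"

lemma convex_infinite_cone: "convex (infinite_cone B)"
proof -
  have "infinite_cone B = (\<Inter>v\<in>B. {x. dual B v \<bullet> x \<ge> dual B v \<bullet> c})"
    by (auto simp: infinite_cone_def inner_diff_right)
  then show ?thesis
    by (simp add: convex_INT convex_halfspace_ge)
qed

lemma shrink_infinite_cone_point:
  assumes B: "B \<in> K" and x: "x \<in> infinite_cone B"
  obtains s where "0 < s" "s \<le> 1" "c + s *\<^sub>R (x - c) \<in> convex hull (insert c B)"
proof -
  define a where "a = (\<lambda>v. dual B v \<bullet> (x - c))"
  have a: "a v \<ge> 0" if "v \<in> B" for v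
    using x that by (simp add: infinite_cone_def a_def)
  define s where "s = 1 / (1 + sum a B)"
  have sa: "sum a B \<ge> 0" using a by (simp add: sum_nonneg)
  have s: "0 < s" "s \<le> 1" "s * sum a B \<le> 1"
    using sa by (auto simp: s_def field_simps)
  have "c + s *\<^sub>R (x - c) = c + s *\<^sub>R (\<Sum>v\<in>B. a v *\<^sub>R (v - c))"
    using dual_coordinates[OF B, of x] by (simp add: a_def)
  also have "\<dots> = (1 - s * sum a B) *\<^sub>R c + (\<Sum>v\<in>B. (s * a v) *\<^sub>R v)"
    by (simp add: scaleR_sum_right scaleR_diff_right sum_subtractf sum_distrib_left scaleR_left.sum[symmetric] algebra_simps)
  also have "\<dots> = (\<Sum>v\<in>insert c B. (if v = c then 1 - s * sum a B else s * a v) *\<^sub>R v)"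
    using apex_notin[OF B] finite_B[OF B] by (auto intro!: sum.cong)
  also have "\<dots> \<in> convex hull (insert c B)"
  proof (rule convex_sum)
    show "(\<Sum>v\<in>insert c B. if v = c then 1 - s * sum a B else s * a v) = 1"
    proof -
      have "(\<Sum>v\<in>B. if v = c then 1 - s * sum a B else s * a v) = (\<Sum>v\<in>B. s * a v)"
        using apex_notin[OF B] by (intro sum.cong) auto
      then show ?thesis
        using apex_notin[OF B] finite_B[OF B] by (simp add: sum_distrib_left)
    qed
    show "0 \<le> (if v = c then 1 - s * sum a B else s * a v)" if "v \<in> insert c B" for v
      using that s a by auto
  qed (use finite_B[OF B] in \<open>auto intro: hull_inc\<close>)
  finally show thesis using s that by blast
qed

text \<open>The perturbation is homogeneous with respect to the apex and fixes the cone over \<open>B0\<close> because \<open>p\<close> is not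
one of its vertices. Shrinking towards the apex until the cone meets the tiling, injectivity shows that no other point of \<open>P\<close> is
moved into this cone.\<close>

lemma moved_point_over_fixed_base:
  assumes small: "hat_slope p * norm (q - p) < 1" and B0: "B0 \<in> K" "p \<notin> B0" and B: "B \<in> K"
    and x: "x \<in> convex hull (insert c (move_vertex p q B))" "x \<in> infinite_cone B0"
  shows "x \<in> P"
proof -
  obtain y where y: "y \<in> convex hull (insert c B)" "x = perturb p q y"
    using x(1) perturb_cone[OF B, of p q] by auto
  obtain s where s: "0 < s" "s \<le> 1" "c + s *\<^sub>R (x - c) \<in> convex hull (insert c B0)"
    using shrink_infinite_cone_point[OF B0(1) x(2)] by blast
  have y': "c + s *\<^sub>R (y - c) \<in> convex hull (insert c B)"
    using convexD_alt[of "convex hull (insert c B)" c y s] s(1,2) y(1)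
    by (simp add: hull_inc algebra_simps)
  have "perturb p q (c + s *\<^sub>R (y - c)) = c + s *\<^sub>R (perturb p q y - c)"
    unfolding perturb_eq[OF B y'] perturb_eq[OF B y(1)] by (simp add: algebra_simps)
  also have "\<dots> = perturb p q (c + s *\<^sub>R (x - c))"
    unfolding y(2)[symmetric] perturb_eq[OF B0(1) s(3)] using B0(2) by simp
  finally have "c + s *\<^sub>R (y - c) = c + s *\<^sub>R (x - c)"
    by (rule inj_onD[OF inj_on_perturb[OF small]]) (use y' s(3) B B0 cover in auto)
  then have "x = y" using s(1) by simp
  then show ?thesis using y(1) B cover by auto
qed

text \<open>The additional volume when \<open>p\<close> lies in the supporting hyperplane of a base \<open>B0\<close> not containing it and moves
outwards. Erect over \<open>B0\<close> the simplex with apex \<open>z = (1 - t) y + t q\<close>, where \<open>y\<close> is the barycentre of \<open>B0\<close> and \<open>t\<close> is so small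
that \<open>z\<close> stays in the cone over \<open>B0\<close>. It lies beyond the supporting hyperplane of \<open>B0\<close>, where the cone over \<open>B0\<close> is free of the moved tiling, and its volume is
proportional to the height \<open>t * (n \<bullet> (q - p))\<close>.\<close>

lemma volume_lower_bound_strict:
  assumes B0: "B0 \<in> K" "p \<notin> B0" and nB0: "\<And>v. v \<in> B0 \<Longrightarrow> n \<bullet> v = b"
    and nP: "\<And>x. x \<in> P \<Longrightarrow> n \<bullet> x \<le> b" and nc: "n \<bullet> c < b" and np: "n \<bullet> p = b"
  obtains \<eta> where "\<eta> > 0"
    "\<And>q W. \<lbrakk>hat_slope p * norm (q - p) < 1; norm (q - p) \<le> 1; n \<bullet> q \<ge> b; convex W; W \<in> lmeasurable;
       c \<in> W; q \<in> W; \<Union>K - {p} \<subseteq> W\<rbrakk> \<Longrightarrow>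
     measure lebesgue P + gradient p \<bullet> (q - p) + \<eta> * (n \<bullet> (q - p)) \<le> measure lebesgue W"
proof -
  let ?d = "real CARD('n)"
  define M where "M = (\<Sum>v\<in>B0. norm (dual B0 v)) * (norm (p - c) + 1)"
  \<comment> \<open>\<open>M\<close> bounds the coordinates of \<open>q\<close>. With this \<open>t\<close> the coordinates \<open>(1 - t) / d\<close> of \<open>(1 - t) y\<close> outweigh \<open>t * M\<close>.\<close>
  define t where "t = 1 / (1 + ?d * M)"
  define y where "y = (1 / ?d) *\<^sub>R (\<Sum>v\<in>B0. v)"
  have fin: "finite B0" by (rule finite_B[OF B0(1)])
  have d: "?d > 0" by simp
  have M: "M \<ge> 0" by (simp add: M_def sum_nonneg)
  have "?d * M \<ge> 0" using M by simp
  then have t: "0 < t" "t \<le> 1" "t * (1 + ?d * M) = 1"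
    by (auto simp: t_def)
  then have "1 - t = ?d * (t * M)" by (simp add: algebra_simps)
  then have tM: "(1 - t) / ?d = t * M" by simp
  have y_hull: "y \<in> convex hull B0"
    unfolding y_def scaleR_sum_right
    by (rule convex_sum) (use fin card_K[OF B0(1)] in \<open>auto intro: hull_inc\<close>)
  have ny: "n \<bullet> y = b"
    using nB0 card_K[OF B0(1)] d by (simp add: y_def inner_sum_right)
  have dual_y: "dual B0 v \<bullet> (y - c) = 1 / ?d" if v: "v \<in> B0" for v
  proof -
    have "(\<Sum>u\<in>B0. c) = ?d *\<^sub>R c"
      using card_K[OF B0(1)] by (simp only: sum_constant_scaleR)
    then have "y - c = (1 / ?d) *\<^sub>R (\<Sum>u\<in>B0. u - c)"
      by (simp add: y_def sum_subtractf scaleR_diff_right del: sum_constant)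
    then have "dual B0 v \<bullet> (y - c) = (1 / ?d) * (\<Sum>u\<in>B0. if u = v then 1 else 0)"
      by (simp add: inner_sum_right dual_inner[OF B0(1)])
    then show ?thesis using v fin by simp
  qed
  define \<eta> where "\<eta> = t / (b - n \<bullet> c) * cone_volume B0"
  have "\<eta> > 0"
    using t nc cone_volume_pos[OF B0(1)] by (simp add: \<eta>_def)
  moreover have "measure lebesgue P + gradient p \<bullet> (q - p) + \<eta> * (n \<bullet> (q - p)) \<le> measure lebesgue W"
    if small: "hat_slope p * norm (q - p) < 1" and q1: "norm (q - p) \<le> 1" and nq: "n \<bullet> q \<ge> b"
      and W: "convex W" "W \<in> lmeasurable" "c \<in> W" "q \<in> W" "\<Union>K - {p} \<subseteq> W" for q W
  proof -
    define z where "z = (1 - t) *\<^sub>R y + t *\<^sub>R q"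
    define E where "E = convex hull (insert z B0)"
    have nz: "n \<bullet> z = b + t * (n \<bullet> q - b)"
      by (simp add: z_def inner_add_right ny algebra_simps)
    have z_cone: "z \<in> infinite_cone B0"
      unfolding infinite_cone_def
    proof (intro CollectI ballI)
      fix v assume v: "v \<in> B0"
      have "norm (q - c) \<le> norm (q - p) + norm (p - c)"
        using norm_triangle_ineq[of "q - p" "p - c"] by simp
      then have "norm (q - c) \<le> norm (p - c) + 1" using q1 by simp
      moreover have "norm (dual B0 v) \<le> (\<Sum>v\<in>B0. norm (dual B0 v))"
        using v fin by (intro member_le_sum) auto
      ultimately have "norm (dual B0 v) * norm (q - c) \<le> M"
        unfolding M_def by (intro mult_mono) (auto simp: sum_nonneg)
      then have "dual B0 v \<bullet> (q - c) \<ge> - M"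
        using Cauchy_Schwarz_ineq2[of "dual B0 v" "q - c"] by linarith
      then have "t * (dual B0 v \<bullet> (q - c)) \<ge> t * (- M)"
        using t(1) by (intro mult_left_mono) auto
      moreover have "z - c = (1 - t) *\<^sub>R (y - c) + t *\<^sub>R (q - c)"
        by (simp add: z_def algebra_simps)
      then have "dual B0 v \<bullet> (z - c) = (1 - t) / ?d + t * (dual B0 v \<bullet> (q - c))"
        by (simp add: inner_add_right dual_y[OF v])
      ultimately show "dual B0 v \<bullet> (z - c) \<ge> 0" using tM by simp
    qed
    have E_cone: "E \<subseteq> infinite_cone B0"
      unfolding E_def
    proof (intro hull_minimal convex_infinite_cone)
      show "insert z B0 \<subseteq> infinite_cone B0"
        using z_cone dual_inner[OF B0(1)] by (auto simp: infinite_cone_def)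
    qed
    have E_above: "E \<subseteq> {x. n \<bullet> x \<ge> b}"
      unfolding E_def
      using nz t(1) nq nB0 by (intro hull_minimal convex_halfspace_ge) auto
    have E_vol: "measure lebesgue E = \<eta> * (n \<bullet> (q - p))"
    proof -
      let ?e = "- (1 / (b - n \<bullet> c)) *\<^sub>R n" and ?r = "b / (b - n \<bullet> c)"
      have aff: "?e \<bullet> x + ?r = (b - n \<bullet> x) / (b - n \<bullet> c)" for x
        by (simp add: diff_divide_distrib)
      have e: "?e \<bullet> c + ?r = 1" "\<And>v. v \<in> B0 \<Longrightarrow> ?e \<bullet> v + ?r = 0"
        using nc by (simp_all only: aff) (auto simp: nB0)
      have "measure lebesgue (convex hull (insert z (insert c B0 - {c}))) = \<bar>?e \<bullet> z + ?r\<bar> * cone_volume B0"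
        by (rule simplex_volume_move_vertex[OF card_insert_apex affine_hull_cone])
          (use B0 e in auto)
      moreover have "insert c B0 - {c} = B0" using apex_notin[OF B0(1)] by auto
      moreover have "?e \<bullet> z + ?r = - (t * (n \<bullet> q - b) / (b - n \<bullet> c))"
        unfolding aff nz by simp
      moreover have "\<bar>- (t * (n \<bullet> q - b) / (b - n \<bullet> c))\<bar> = t * (n \<bullet> q - b) / (b - n \<bullet> c)"
        using t(1) nq nc by (simp add: abs_mult)
      ultimately have "measure lebesgue E = t * (n \<bullet> q - b) / (b - n \<bullet> c) * cone_volume B0"
        unfolding E_def by metis
      then show ?thesis
        by (simp add: \<eta>_def inner_diff_right np)
    qed
    let ?U = "\<Union>B\<in>K. convex hull (insert c (move_vertex p q B))"
    have cpt: "compact E" "compact ?U"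
      using fin by (auto simp: E_def finite_imp_compact_convex_hull intro!: compact_UN finite_K compact_moved_cone)
    have "E \<inter> ?U \<subseteq> {x. n \<bullet> x = b}"
    proof
      fix x assume x: "x \<in> E \<inter> ?U"
      then have "x \<in> P"
        using moved_point_over_fixed_base[OF small B0] E_cone by auto
      then show "x \<in> {x. n \<bullet> x = b}"
        using nP[of x] E_above x by auto
    qed
    moreover have "n \<noteq> 0" using nc np by auto
    ultimately have "negligible (?U \<inter> E)"
      using negligible_subset[OF negligible_hyperplane[of n b]] by (simp add: Int_commute)
    then have "measure lebesgue (?U \<union> E) = measure lebesgue ?U + measure lebesgue E"
      using cpt by (simp add: measure_Un3 lmeasurable_compact negligible_imp_measure0)
    moreover have "measure lebesgue (?U \<union> E) \<le> measure lebesgue W"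
    proof (rule measure_mono_fmeasurable)
      have B0W: "B0 \<subseteq> W" using B0 W(5) by blast
      then have "y \<in> W" using y_hull hull_minimal[of B0 W convex] B0W W(1) by blast
      then have "z \<in> W"
        unfolding z_def using t W(1,4) by (intro convexD) auto
      then have "E \<subseteq> W"
        unfolding E_def using B0W W(1) by (intro hull_minimal) auto
      then show "?U \<union> E \<subseteq> W"
        using moved_cone_subset[OF W(1,3,4,5)] by blast
      show "?U \<union> E \<in> sets lebesgue"
        using cpt by (intro fmeasurableD lmeasurable_compact compact_Un)
    qed fact
    ultimately show ?thesis
      using moved_volume[OF small] E_vol by simp
  qed
  ultimately show thesis by (rule that) 
qed

text \<open>Moving \<open>p\<close> along the line towards the apex scales every simplex at \<open>p\<close> linearly, so this derivative is the
volume of the star of \<open>p\<close>.\<close>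

lemma gradient_inner_apex:
  "gradient p \<bullet> (p - c) = (\<Sum>B\<in>{B\<in>K. p \<in> B}. cone_volume B)"
proof -
  have "gradient p \<bullet> (p - c) = (\<Sum>B\<in>K. cone_volume B * (dual B p \<bullet> (p - c)))"
    by (simp add: gradient_def inner_sum_left)
  also have "\<dots> = (\<Sum>B\<in>K. if p \<in> B then cone_volume B else 0)"
    by (intro sum.cong) (auto simp: dual_inner)
  finally show ?thesis
    by (simp add: sum.inter_filter finite_K)
qed

end

text \<open>For a base \<open>B\<close> the sum of its dual vectors is, up to the sign, the derivative of the relative volume of the
cone over \<open>B\<close> with respect to the apex. The cones tile \<open>P\<close> for every interior apex, so the derivative of the total volume
vanishes. This is Minkowski's relation between the areas and normals of the boundary simplices.\<close>

lemma sum_dual_vectors_eq_0: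
  fixes P :: "(real^'n::finite) set"
  assumes c: "c \<in> interior P" and cplx: "\<And>c'. c' \<in> interior P \<Longrightarrow> coned_complex P c' K"
  shows "(\<Sum>B\<in>K. measure lebesgue (convex hull (insert c B)) *\<^sub>R (\<Sum>p\<in>B. dual_vector c B p)) = 0"
proof -
  interpret coned_complex P c K by (rule cplx[OF c])
  \<comment> \<open>Relative to \<open>c\<close>, the functional \<open>s B\<close> is \<open>1\<close> on the hyperplane of \<open>B\<close>.\<close>
  define s where "s = (\<lambda>B. \<Sum>p\<in>B. dual B p)"
  have s1: "s B \<bullet> (v - c) = 1" if B: "B \<in> K" "v \<in> B" for B v
    using B finite_B[OF B(1)] by (simp add: s_def inner_sum_left dual_inner)
  have vol: "measure lebesgue (convex hull (insert c' B)) = \<bar>1 - s B \<bullet> (c' - c)\<bar> * cone_volume B"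
    if B: "B \<in> K" for B c'
  proof -
    have "measure lebesgue (convex hull (insert c' (insert c B - {c}))) =
        \<bar>(- s B) \<bullet> c' + (1 + s B \<bullet> c)\<bar> * cone_volume B"
      by (rule simplex_volume_move_vertex[OF card_insert_apex affine_hull_cone])
        (use B in \<open>auto simp: inner_diff_right algebra_simps dest: s1\<close>)
    moreover have "insert c B - {c} = B" using apex_notin[OF B] by auto
    ultimately show ?thesis by (simp add: inner_diff_right algebra_simps)
  qed
  define g where "g = (\<Sum>B\<in>K. cone_volume B *\<^sub>R s B)"
  have "eventually (\<lambda>c'. c' \<in> interior P \<and> (\<forall>B\<in>K. s B \<bullet> (c' - c) < 1)) (nhds c)"
  proof (intro eventually_conj eventually_ball_finite finite_K ballI)
    show "eventually (\<lambda>c'. c' \<in> interior P) (nhds c)"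
      using c by (intro eventually_nhds_in_open) auto
    show "eventually (\<lambda>c'. s B \<bullet> (c' - c) < 1) (nhds c)" for B
    proof (rule order_tendstoD(2))
      show "((\<lambda>c'. s B \<bullet> (c' - c)) \<longlongrightarrow> s B \<bullet> (c - c)) (nhds c)"
        by (intro tendsto_intros filterlim_ident)
    qed simp
  qed
  then obtain \<epsilon> where \<epsilon>: "\<epsilon> > 0" 
    "\<And>c'. dist c' c < \<epsilon> \<Longrightarrow> c' \<in> interior P \<and> (\<forall>B\<in>K. s B \<bullet> (c' - c) < 1)"
    unfolding eventually_nhds_metric by blast
  have zero: "g \<bullet> (c' - c) = 0" if "dist c' c < \<epsilon>" for c'
  proof -
    have c': "c' \<in> interior P" "\<And>B. B \<in> K \<Longrightarrow> s B \<bullet> (c' - c) < 1"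
      using \<epsilon>(2)[OF that] by auto
    have "measure lebesgue P = (\<Sum>B\<in>K. measure lebesgue (convex hull (insert c' B)))"
      using coned_complex.measure_P[OF cplx[OF c'(1)]] .
    also have "\<dots> = (\<Sum>B\<in>K. cone_volume B - cone_volume B * (s B \<bullet> (c' - c)))"
    proof (intro sum.cong refl)
      fix B assume B: "B \<in> K"
      show "measure lebesgue (convex hull (insert c' B)) = cone_volume B - cone_volume B * (s B \<bullet> (c' - c))"
      proof -
        have "\<bar>1 - s B \<bullet> (c' - c)\<bar> = 1 - s B \<bullet> (c' - c)"
          using c'(2)[OF B] by (intro abs_of_nonneg) linarith
        then show ?thesis
          unfolding vol[OF B, of c'] by (simp add: left_diff_distrib mult.commute)
      qed
    qed
    also have "\<dots> = measure lebesgue P - g \<bullet> (c' - c)"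
      by (simp add: measure_P sum_subtractf g_def inner_sum_left)
    finally show ?thesis by simp
  qed
  \<comment> \<open>Test the vanishing functional on a small multiple of \<open>g\<close> itself.\<close>
  define N where "N = norm g + 1"
  define r where "r = \<epsilon> / (2 * N)"
  have N: "N > 0" "norm g \<le> N" by (auto simp: N_def add_nonneg_pos)
  then have r: "r > 0" using \<epsilon>(1) by (simp add: r_def)
  have "r * norm g < \<epsilon>"
  proof -
    have "r * norm g \<le> r * N" using r N(2) by simp
    also have "\<dots> = \<epsilon> / 2" using N(1) by (simp add: r_def)
    finally show ?thesis using \<epsilon>(1) by simp
  qed
  then have "g \<bullet> ((c + r *\<^sub>R g) - c) = 0"
    using r by (intro zero) (simp add: dist_norm)
  then have "g = 0" using r by simp
  then show ?thesis by (simp add: g_def s_def)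
qed

section \<open>A triangulated boundary seen from an interior point\<close>

lemma vertices_convex_hull:
  fixes B :: "'a::euclidean_space set"
  shows "\<not> affine_dependent B \<Longrightarrow> vertices (convex hull B) = B"
  by (simp add: vertices_def extreme_point_of_convex_hull_affine_independent)

lemma simplex_vertices:
  assumes "k simplex F"
  shows "F = convex hull (vertices F)" "\<not> affine_dependent (vertices F)" "int (card (vertices F)) = k + 1"
proof -
  obtain B where "\<not> affine_dependent B" "int (card B) = k + 1" "F = convex hull B"
    using assms by (auto simp: simplex_def)
  then show "F = convex hull (vertices F)" "\<not> affine_dependent (vertices F)" "int (card (vertices F)) = k + 1"
    by (simp_all add: vertices_convex_hull)
qed

lemma convex_hull_vertices:
  fixes S :: "'a::euclidean_space set"
  shows "compact S \<Longrightarrow> convex S \<Longrightarrow> convex hull (vertices S) = S"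
  using Krein_Milman_Minkowski[of S] by (simp add: vertices_def)

lemma ray_point_interior:
  assumes "convex P" "c \<in> interior P" "y \<in> P" "0 \<le> t" "t < 1"
  shows "c + t *\<^sub>R (y - c) \<in> interior (P :: 'a::euclidean_space set)"
  using mem_interior_convex_shrink[OF assms(1-3), of "1 - t"] assms(4,5)
  by (simp add: algebra_simps)

text \<open>A ray from an interior point leaves a convex set only once.\<close>

lemma frontier_point_on_ray_unique:
  fixes P :: "'a::euclidean_space set"
  assumes P: "convex P" "closed P" and c: "c \<in> interior P" and y: "y \<in> frontier P" "y' \<in> frontier P"
    and s: "0 < s" "0 < s'" and eq: "c + s *\<^sub>R (y - c) = c + s' *\<^sub>R (y' - c)"
  shows "y = y'"
proof -
  have impossible: False
    if y: "y \<in> frontier P" "y' \<in> frontier P" and s: "0 < s" "s < s'" 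
      and eq: "s *\<^sub>R (y - c) = s' *\<^sub>R (y' - c)" for y y' s s'
  proof -
    have "y' - c = (1 / s') *\<^sub>R (s' *\<^sub>R (y' - c))" using s by simp
    also have "\<dots> = (s / s') *\<^sub>R (y - c)" unfolding eq[symmetric] by simp
    finally have "y' = c + (s / s') *\<^sub>R (y - c)" by (simp add: algebra_simps)
    also have "\<dots> \<in> interior P"
      using y(1) P s by (intro ray_point_interior c) (auto simp: frontier_def)
    finally show False using y(2) by (simp add: frontier_def)
  qed
  have "s = s'"
    using impossible[OF y, of s s'] impossible[OF y(2,1), of s' s] s eq by fastforce
  then show ?thesis using eq s by simp
qed

lemma mem_convex_hull_insertE:
  assumes "x \<in> convex hull (insert c B)" "x \<noteq> c"
  obtains s y where "0 < s" "s \<le> 1" "y \<in> convex hull B" "x = c + s *\<^sub>R (y - c)"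
proof -
  have "B \<noteq> {}" using assms by auto
  then obtain u y where "x = (1 - u) *\<^sub>R c + u *\<^sub>R y" "0 \<le> u" "u \<le> 1" "y \<in> convex hull B"
    using assms(1) by (auto simp: convex_hull_insert_alt)
  moreover from this have "u \<noteq> 0" using assms(2) by auto
  ultimately show thesis
    by (intro that[of u y]) (auto simp: algebra_simps)
qed

text \<open>A point of both cones lies on a single ray from \<open>c\<close>, hence over a common point of the two boundary pieces.\<close>

lemma cones_meet:
  fixes P :: "'a::euclidean_space set"
  assumes P: "convex P" "closed P" and c: "c \<in> interior P"
    and B: "convex hull B \<subseteq> frontier P" "convex hull B' \<subseteq> frontier P"
    and T: "convex hull B \<inter> convex hull B' \<subseteq> convex hull T"
  shows "convex hull (insert c B) \<inter> convex hull (insert c B') \<subseteq> convex hull (insert c T)"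
proof
  fix x assume x: "x \<in> convex hull (insert c B) \<inter> convex hull (insert c B')"
  show "x \<in> convex hull (insert c T)"
  proof (cases "x = c")
    case False
    obtain s y where y: "0 < s" "s \<le> 1" "y \<in> convex hull B" "x = c + s *\<^sub>R (y - c)"
      using mem_convex_hull_insertE[OF _ False] x by blast
    obtain s' y' where y': "0 < s'" "y' \<in> convex hull B'" "x = c + s' *\<^sub>R (y' - c)"
      using mem_convex_hull_insertE[OF _ False] x by blast
    have "y = y'"
      by (rule frontier_point_on_ray_unique[OF P c, of y y' s s']) (use y y' B in auto)
    then have "y \<in> convex hull (insert c T)"
      using T y y' hull_mono[of T "insert c T" convex] by blast
    moreover have "x = (1 - s) *\<^sub>R c + s *\<^sub>R y" using y by (simp add: algebra_simps)
    ultimately show ?thesis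
      using y(1,2) by (auto intro!: convexD simp: hull_inc)
  qed (simp add: hull_inc)
qed

text \<open>A hyperplane that supports \<open>P\<close> at a relative interior point of \<open>S\<close> contains \<open>S\<close>: otherwise a segment in \<open>S\<close> would
cross it.\<close>

lemma convex_subset_frontier_support:
  fixes P :: "'a::euclidean_space set"
  assumes P: "convex P" "closed P" "interior P \<noteq> {}" and S: "convex S" "S \<noteq> {}" "S \<subseteq> frontier P"
  obtains n b where "\<And>x. x \<in> P \<Longrightarrow> n \<bullet> x \<le> b" "\<And>x. x \<in> S \<Longrightarrow> n \<bullet> x = b"
    "\<And>x. x \<in> interior P \<Longrightarrow> n \<bullet> x < b"
proof -
  obtain y where y: "y \<in> rel_interior S"
    using S rel_interior_eq_empty by blast
  then have "y \<in> S" using rel_interior_subset by blast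
  have SP: "S \<subseteq> P" using S(3) P(2) frontier_subset_closed by blast
  have ri: "rel_interior P = interior P"
    using P(3) by (simp add: rel_interior_nonempty_interior)
  have "y \<notin> rel_interior P" using \<open>y \<in> S\<close> S(3) ri by (auto simp: frontier_def)
  then obtain a where a: "\<And>x. x \<in> P \<Longrightarrow> a \<bullet> y \<le> a \<bullet> x" "\<And>x. x \<in> rel_interior P \<Longrightarrow> a \<bullet> y < a \<bullet> x"
  proof -
    have "y \<in> P" using SP \<open>y \<in> S\<close> by blast
    from supporting_hyperplane_rel_boundary[OF P(1) this \<open>y \<notin> rel_interior P\<close>]
    show thesis using that by metis
  qed
  have "a \<bullet> x = a \<bullet> y" if x: "x \<in> S" for x
  proof (rule ccontr)
    assume "a \<bullet> x \<noteq> a \<bullet> y"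
    then have less: "a \<bullet> y < a \<bullet> x" using a(1)[of x] x SP by fastforce
    have "x \<in> affine hull S" using x by (simp add: hull_inc)
    then obtain m where m: "m > 1" "\<forall>e. e > 1 \<and> e \<le> m \<longrightarrow> (1 - e) *\<^sub>R x + e *\<^sub>R y \<in> S"
      using convex_rel_interior_if[OF S(1) y] by blast
    then have "(1 - m) *\<^sub>R x + m *\<^sub>R y \<in> P" using SP by auto
    from a(1)[OF this] have "(m - 1) * (a \<bullet> x - a \<bullet> y) \<le> 0"
      by (simp add: inner_add_right algebra_simps)
    then show False using m(1) less by (simp add: mult_le_0_iff)
  qed
  then show thesis
    using a ri by (intro that[of "- a" "- (a \<bullet> y)"]) auto
qed

text \<open>The setting of the theorem apart from the sphere. That the simplices of dimension \<open>d - 1\<close> exhaust the boundary and lie in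
supporting hyperplanes is derived from \<open>\<Union>C = frontier P\<close>.\<close>

locale boundary_triangulation =
  fixes P :: "(real^'n::finite) set" and C :: "(real^'n) set set"
  assumes polytope_P: "polytope P" and full_dim: "aff_dim P = int CARD('n)"
    and complex_C: "simplicial_complex C"
    and frontier_C: "\<Union>C = frontier P"
    and vertices_C: "complex_vertices C = vertices P"
begin

definition facets :: "(real^'n) set set" where
  "facets = {F \<in> C. (int CARD('n) - 1) simplex F}"

definition K :: "(real^'n) set set" where
  "K = vertices ` facets"

lemma convex_P: "convex P" and compact_P: "compact P" and closed_P: "closed P"
  using polytope_P by (auto simp: polytope_imp_convex polytope_imp_compact compact_imp_closed)

lemma interior_nonempty: "interior P \<noteq> {}"
proof -
  have "affine hull P = UNIV"
    using full_dim by (simp flip: aff_dim_eq_full)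
  moreover have "P \<noteq> {}" using full_dim by auto
  ultimately show ?thesis
    using rel_interior_eq_empty[OF convex_P] by (simp add: rel_interior_interior)
qed

lemma finite_C: "finite C"
  using complex_C by (simp add: simplicial_complex_def)

lemma C_simplex: "F \<in> C \<Longrightarrow> \<exists>k. k simplex F"
  using complex_C by (simp add: simplicial_complex_def)

lemma face_in_C: "F \<in> C \<Longrightarrow> G face_of F \<Longrightarrow> G \<in> C"
  using complex_C by (simp add: simplicial_complex_def) blast

lemma Int_face_C: "F \<in> C \<Longrightarrow> G \<in> C \<Longrightarrow> F \<inter> G face_of F"
  using complex_C by (simp add: simplicial_complex_def)

lemma facetD:
  assumes "F \<in> facets"
  shows "F \<in> C" "convex hull (vertices F) = F" "\<not> affine_dependent (vertices F)" "card (vertices F) = CARD('n)"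
  using assms simplex_vertices[of "int CARD('n) - 1" F] by (auto simp: facets_def)

lemma C_subset_frontier: "F \<in> C \<Longrightarrow> F \<subseteq> frontier P"
  using frontier_C by blast

lemma KD:
  assumes "B \<in> K"
  shows "convex hull B \<in> C" "convex hull B \<subseteq> frontier P" "\<not> affine_dependent B" "card B = CARD('n)" "vertices (convex hull B) = B"
proof -
  obtain F where "F \<in> facets" "B = vertices F" using assms by (auto simp: K_def)
  then show "convex hull B \<in> C" "convex hull B \<subseteq> frontier P" "\<not> affine_dependent B"
      "card B = CARD('n)" "vertices (convex hull B) = B"
    using facetD[of F] C_subset_frontier[of F] by simp_all
qed

lemma finite_K: "finite K"
  using finite_C by (simp add: K_def facets_def)

lemma vertices_Int_C:
  assumes "F \<in> C" "G \<in> C"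
  shows "F \<inter> G \<subseteq> convex hull (vertices F \<inter> vertices G)"
proof -
  have F: "F \<inter> G face_of F" and G: "F \<inter> G face_of G"
    using Int_face_C[OF assms] Int_face_C[OF assms(2,1)] by (auto simp: Int_commute)
  have "compact (F \<inter> G)" "convex (F \<inter> G)"
    using assms C_simplex by (meson compact_Int convex_Int compact_simplex convex_simplex)+
  then have "F \<inter> G = convex hull (vertices (F \<inter> G))"
    by (simp add: convex_hull_vertices)
  also have "vertices (F \<inter> G) \<subseteq> vertices F \<inter> vertices G"
    using extreme_point_of_face[OF F] extreme_point_of_face[OF G] by (auto simp: vertices_def)
  finally show ?thesis by (simp add: hull_mono)
qed

lemma C_support:
  assumes "F \<in> C" "F \<noteq> {}"
  obtains n b where "\<And>x. x \<in> P \<Longrightarrow> n \<bullet> x \<le> b" "\<And>x. x \<in> F \<Longrightarrow> n \<bullet> x = b" "\<And>x. x \<in> interior P \<Longrightarrow> n \<bullet> x < b"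
  using convex_subset_frontier_support[OF convex_P closed_P interior_nonempty, of F]
    C_subset_frontier assms C_simplex convex_simplex by metis

lemma frontier_point_below:
  assumes c: "c \<in> interior P" and x: "x \<in> P" "x \<noteq> c"
  shows "\<exists>F\<in>C. x \<in> convex hull (insert c F)"
proof -
  obtain d where d: "0 < d" "c + d *\<^sub>R (x - c) \<in> frontier P"
    using ray_to_frontier[OF compact_imp_bounded[OF compact_P] c, of "x - c"] x by auto
  have "1 \<le> d"
  proof (rule ccontr)
    assume "\<not> 1 \<le> d"
    then have "c + d *\<^sub>R (x - c) \<in> interior P"
      using d x c by (intro ray_point_interior convex_P) auto
    then show False using d by (simp add: frontier_def)
  qed
  obtain F where F: "F \<in> C" "c + d *\<^sub>R (x - c) \<in> F" using d(2) frontier_C by blast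
  have "x = (1 - 1 / d) *\<^sub>R c + (1 / d) *\<^sub>R (c + d *\<^sub>R (x - c))"
    using d(1) by (simp add: algebra_simps)
  also have "\<dots> \<in> convex hull (insert c F)"
    using \<open>1 \<le> d\<close> F by (intro convexD convex_convex_hull) (auto intro: hull_inc)
  finally show ?thesis using F by blast
qed

text \<open>Every point lies on a ray through some simplex of \<open>C\<close>. Cones over simplices of dimension below \<open>d - 1\<close> are null sets,
so the remaining cones, a closed set, already contain the interior of \<open>P\<close> and with it \<open>P\<close>.\<close>

lemma cover:
  assumes c: "c \<in> interior P"
  shows "P = (\<Union>B\<in>K. convex hull (insert c B))"
proof
  show "(\<Union>B\<in>K. convex hull (insert c B)) \<subseteq> P"
  proof (intro UN_least hull_minimal convex_P)
    fix B assume "B \<in> K"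
    then have "B \<subseteq> frontier P" using KD(2) hull_subset[of B convex] by blast
    then show "insert c B \<subseteq> P"
      using c interior_subset frontier_subset_closed[OF closed_P] by auto
  qed
  let ?Q = "\<Union>B\<in>K. convex hull (insert c B)"
  have "compact ?Q"
    using KD(3) by (intro compact_UN finite_K finite_imp_compact_convex_hull) (auto simp: aff_independent_finite)
  then have Q: "closed ?Q" by (rule compact_imp_closed)
  let ?N = "\<Union>F\<in>C - facets. convex hull (insert c F)"
  have "negligible ?N"
  proof (rule negligible_Union)
    show "finite ((\<lambda>F. convex hull (insert c F)) ` (C - facets))" using finite_C by simp
    fix X assume "X \<in> (\<lambda>F. convex hull (insert c F)) ` (C - facets)"
    then obtain F where F: "F \<in> C" "F \<notin> facets" and X: "X = convex hull (insert c F)" by auto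
    show "negligible X"
    proof (cases "F = {}")
      case False
      obtain k where k: "k simplex F" using C_simplex[OF F(1)] by blast
      obtain n b where n: "\<And>x. x \<in> F \<Longrightarrow> n \<bullet> x = b" "\<And>x. x \<in> interior P \<Longrightarrow> n \<bullet> x < b"
        using C_support[OF F(1) False] by metis
      have "n \<noteq> 0" using n(2)[OF c] n(1) False by force
      have "aff_dim F \<le> aff_dim {x. n \<bullet> x = b}"
        using n(1) by (intro aff_dim_subset) auto
      then have "k \<le> int CARD('n) - 1"
        using \<open>n \<noteq> 0\<close> aff_dim_simplex[OF k] by (simp add: aff_dim_hyperplane)
      moreover have "k \<noteq> int CARD('n) - 1" using F k by (auto simp: facets_def)
      moreover have "aff_dim (insert c F) \<le> aff_dim F + 1" by (simp add: aff_dim_insert)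
      ultimately have "aff_dim (insert c F) < DIM(real^'n)"
        using aff_dim_simplex[OF k] by simp
      then show ?thesis unfolding X
        by (intro negligible_aff_dim) (simp add: aff_dim_convex_hull)
    qed (simp add: X)
  qed
  moreover have "interior P - ?Q \<subseteq> insert c ?N"
  proof
    fix x assume x: "x \<in> interior P - ?Q"
    show "x \<in> insert c ?N"
    proof (cases "x = c")
      case False
      then obtain F where F: "F \<in> C" "x \<in> convex hull (insert c F)"
        using frontier_point_below[OF c, of x] x interior_subset by blast
      have "F \<notin> facets"
      proof
        assume *: "F \<in> facets"
        then have "convex hull (insert c F) = convex hull (insert c (vertices F))"
          using facetD(2)[OF *] hull_insert[of convex c "vertices F"] by simp
        then show False using * x F by (auto simp: K_def)
      qed
      then show ?thesis using F by auto
    qed simp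
  qed
  ultimately have "negligible (interior P - ?Q)"
    by (meson negligible_insert negligible_subset)
  moreover have "open (interior P - ?Q)" using Q by (simp add: open_Diff)
  ultimately have "interior P \<subseteq> ?Q" using open_not_negligible by blast
  then have "closure (interior P) \<subseteq> ?Q" using Q by (rule closure_minimal)
  then show "P \<subseteq> ?Q"
    using convex_closure_interior[OF convex_P interior_nonempty] closure_subset by blast
qed

lemma coned_complex:
  assumes c: "c \<in> interior P"
  shows "coned_complex P c K"
proof
  fix B assume B: "B \<in> K"
  have "B \<noteq> {}" using KD(4)[OF B] by auto
  then obtain n b where n: "\<And>x. x \<in> convex hull B \<Longrightarrow> n \<bullet> x = b" "\<And>x. x \<in> interior P \<Longrightarrow> n \<bullet> x < b"
    using C_support[OF KD(1)[OF B]] by (metis convex_hull_eq_empty)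
  have "affine hull B \<subseteq> {x. n \<bullet> x = b}"
    using n(1) by (intro hull_minimal affine_hyperplane) (auto simp: hull_inc)
  then have "c \<notin> affine hull B" using n(2)[OF c] by auto
  then show "\<not> affine_dependent (insert c B)" "c \<notin> B"
    using KD(3)[OF B] by (auto simp: affine_independent_insert hull_inc)
  show "card B = CARD('n)" by (rule KD[OF B])
next
  fix B B' assume B: "B \<in> K" "B' \<in> K"
  have "convex hull B \<inter> convex hull B' \<subseteq> convex hull (B \<inter> B')"
    using vertices_Int_C[OF KD(1)[OF B(1)] KD(1)[OF B(2)]] KD(5) B by simp
  then show "convex hull (insert c B) \<inter> convex hull (insert c B') \<subseteq> convex hull (insert c (B \<inter> B'))"
    using cones_meet[OF convex_P closed_P c] KD(2) B by metis
qed (use finite_K convex_P cover[OF c] in auto)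

lemma K_subset_vertices: "B \<in> K \<Longrightarrow> B \<subseteq> vertices P"
proof
  fix v assume B: "B \<in> K" "v \<in> B"
  then have "{v} face_of (convex hull B)"
    using KD(5)[OF B(1)] by (auto simp: face_of_singleton vertices_def)
  then have "{v} \<in> C" by (rule face_in_C[OF KD(1)[OF B(1)]])
  then show "v \<in> vertices P" using vertices_C by (auto simp: complex_vertices_def)
qed

lemma finite_vertices: "finite (vertices P)"
  using finite_polyhedron_extreme_points[OF polytope_imp_polyhedron[OF polytope_P]] by (simp add: vertices_def)

lemma vertex_not_interior: "p \<in> vertices P \<Longrightarrow> p \<notin> interior P"
  by (auto simp: vertices_def extreme_point_not_in_interior)

lemma vertex_in_subset:
  assumes "p \<in> vertices P" "p \<in> convex hull B" "convex hull B \<subseteq> P"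
  shows "p \<in> B"
proof -
  have "p extreme_point_of (convex hull B)"
    using assms by (auto simp: vertices_def extreme_point_of_def)
  then show ?thesis by (rule extreme_point_of_convex_hull)
qed

lemma vertex_in_K:
  assumes p: "p \<in> vertices P"
  obtains B where "B \<in> K" "p \<in> B"
proof -
  obtain c where c: "c \<in> interior P" using interior_nonempty by blast
  have "p \<in> P" using p by (simp add: vertices_def extreme_point_of_def)
  then obtain B where B: "B \<in> K" "p \<in> convex hull (insert c B)" using cover[OF c] by blast
  have "convex hull (insert c B) \<subseteq> P" using cover[OF c] B(1) by blast
  then have "p \<in> insert c B" by (rule vertex_in_subset[OF p B(2)])
  then show thesis using that B p c vertex_not_interior by blast
qed

text \<open>If a hyperplane separated \<open>c\<close> from the moved hull, then \<open>p\<close> would be the only vertex beyond the parallel hyperplane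
through \<open>c\<close>. As \<open>P\<close> contains a ball around \<open>c\<close>, it would lie beyond by at least half the radius, and \<open>q\<close> could not be on the
other side.\<close>

lemma interior_point_in_moved_hull:
  assumes c: "c \<in> interior P"
  obtains \<delta> where "\<delta> > 0" "\<And>p q. norm (q - p) < \<delta> \<Longrightarrow> c \<in> convex hull (vertices P - {p} \<union> {q})"
proof -
  obtain r where r: "r > 0" "ball c r \<subseteq> P" using c by (auto simp: mem_interior)
  show thesis
  proof (rule that[of "r / 2"])
    fix p q :: "real^'n" assume q: "norm (q - p) < r / 2"
    let ?W = "convex hull (vertices P - {p} \<union> {q})"
    show "c \<in> ?W"
    proof (rule ccontr)
      assume "c \<notin> ?W"
      moreover have "closed ?W"
        using finite_vertices by (intro compact_imp_closed finite_imp_compact_convex_hull) auto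
      ultimately obtain a b where ab: "a \<bullet> c < b" "\<forall>x\<in>?W. a \<bullet> x > b"
        using separating_hyperplane_closed_point[of ?W c] by auto
      have av: "a \<bullet> v > a \<bullet> c" if "v \<in> vertices P - {p} \<union> {q}" for v
        using ab(1) bspec[OF ab(2) hull_inc[OF that]] by simp
      then have aq: "a \<bullet> q > a \<bullet> c" by simp
      have "a \<noteq> 0" using aq by auto
      \<comment> \<open>A point of the ball around \<open>c\<close>, on the far side of \<open>c\<close> from the hull.\<close>
      let ?x = "c - (r / 2 / norm a) *\<^sub>R a"
      have "?x \<in> P" using r \<open>a \<noteq> 0\<close> by (intro subsetD[OF r(2)]) (simp add: dist_norm)
      have "a \<bullet> a = norm a * norm a" by (metis dot_square_norm power2_eq_square)
      then have ax: "a \<bullet> ?x = a \<bullet> c - r / 2 * norm a"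
        using \<open>a \<noteq> 0\<close> by (simp add: inner_diff_right)
      have "a \<bullet> p \<le> a \<bullet> ?x"
      proof (rule ccontr)
        assume *: "\<not> a \<bullet> p \<le> a \<bullet> ?x"
        have "vertices P \<subseteq> {x. a \<bullet> x > a \<bullet> ?x}"
        proof
          fix v assume "v \<in> vertices P"
          moreover have "r / 2 * norm a \<ge> 0" using r by simp
          ultimately show "v \<in> {x. a \<bullet> x > a \<bullet> ?x}"
            using * av[of v] ax by (cases "v = p") auto
        qed
        then have "convex hull (vertices P) \<subseteq> {x. a \<bullet> x > a \<bullet> ?x}"
          by (intro hull_minimal convex_halfspace_gt)
        then show False
          using \<open>?x \<in> P\<close> convex_hull_vertices[OF compact_P convex_P] by auto
      qed
      moreover have "a \<bullet> (q - p) \<le> norm a * (r / 2)"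
        using norm_cauchy_schwarz[of a "q - p"] mult_left_mono[of "norm (q - p)" "r / 2" "norm a"] q by simp
      ultimately show False
        using aq ax by (simp add: inner_diff_right mult.commute)
    qed
  qed (use r in simp)
qed

end

section \<open>Critical points on the sphere\<close>

text \<open>Along the great circle through \<open>p\<close> with direction \<open>w\<close>, both linear functions have positive derivative at \<open>p\<close>. Two
functions are needed since the gain over a facet is only available on the outer side of its hyperplane.\<close>

lemma sphere_ascent_two:
  fixes p w m1 m2 :: "'a::real_inner"
  assumes p: "norm p = 1" and w: "p \<bullet> w = 0" and m: "m1 \<bullet> w > 0" "m2 \<bullet> w > 0" and \<delta>: "\<delta> > 0"
  obtains q where "norm q = 1" "norm (q - p) < \<delta>" "m1 \<bullet> (q - p) > 0" "m2 \<bullet> (q - p) > 0"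
proof -
  define u where "u = w /\<^sub>R norm w"
  have "w \<noteq> 0" using m by auto
  then have u: "norm u = 1" "p \<bullet> u = 0" "m1 \<bullet> u > 0" "m2 \<bullet> u > 0"
    using w m by (auto simp: u_def)
  define s where "s = min (\<delta> / 4) (min (m1 \<bullet> u / (norm m1 + 1)) (m2 \<bullet> u / (norm m2 + 1)))"
  have s: "s > 0" "2 * s < \<delta>"
    using \<delta> u norm_ge_zero[of m1] norm_ge_zero[of m2] by (auto simp: s_def add_nonneg_pos)
  define r where "r = 1 + s\<^sup>2"
  have r: "r \<ge> 1" "r > 0" by (auto simp: r_def add_pos_nonneg)
  \<comment> \<open>Rational parametrisation of the great circle through \<open>p\<close> in direction \<open>u\<close>.\<close>
  define q where "q = ((1 - s\<^sup>2) / r) *\<^sub>R p + (2 * s / r) *\<^sub>R u"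
  have pp: "p \<bullet> p = 1" "u \<bullet> u = 1" "u \<bullet> p = 0" using p u by (auto simp: norm_eq_1 inner_commute)
  have coef: "(1 - s\<^sup>2) / r - 1 = - (2 * s * s / r)"
    using r by (simp add: r_def field_simps power2_eq_square)
  have qp: "q - p = (2 * s / r) *\<^sub>R (u - s *\<^sub>R p)"
  proof -
    have "q - p = ((1 - s\<^sup>2) / r - 1) *\<^sub>R p + (2 * s / r) *\<^sub>R u"
      by (simp add: q_def algebra_simps)
    then show ?thesis unfolding coef by (simp add: algebra_simps)
  qed
  have "q \<bullet> q = ((1 - s\<^sup>2) / r)\<^sup>2 + (2 * s / r)\<^sup>2"
    using pp u(2) by (simp add: q_def inner_add_left inner_add_right power2_eq_square)
  also have "\<dots> = ((1 - s\<^sup>2)\<^sup>2 + (2 * s)\<^sup>2) / r\<^sup>2"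
    by (simp add: power_divide add_divide_distrib)
  also have "(1 - s\<^sup>2)\<^sup>2 + (2 * s)\<^sup>2 = r\<^sup>2"
    by (simp add: r_def power2_eq_square algebra_simps)
  finally have "norm q = 1" using r by (simp add: norm_eq_1)
  moreover have "norm (q - p) < \<delta>"
  proof -
    have "(u - s *\<^sub>R p) \<bullet> (u - s *\<^sub>R p) = r"
      using pp u(2) by (simp add: inner_diff_left inner_diff_right r_def power2_eq_square)
    then have "norm (u - s *\<^sub>R p) = sqrt r" by (simp add: norm_eq_sqrt_inner)
    moreover have "sqrt r \<le> r"
      using r by (intro real_le_lsqrt) (auto simp: power2_eq_square)
    ultimately have "norm (q - p) \<le> (2 * s / r) * r"
      unfolding qp norm_scaleR using s r by (intro mult_mono) auto
    then show ?thesis using r s by simp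
  qed
  moreover have "m \<bullet> (q - p) > 0" if "s \<le> m \<bullet> u / (norm m + 1)" "m \<bullet> u > 0" for m
  proof -
    have "norm m + 1 > 0" by (simp add: add_nonneg_pos)
    then have "s * (norm m + 1) \<le> m \<bullet> u" using that(1) by (simp add: pos_le_divide_eq)
    moreover have "m \<bullet> p \<le> norm m" using norm_cauchy_schwarz[of m p] p by simp
    then have "s * (m \<bullet> p) \<le> s * norm m" using s by (intro mult_left_mono) auto
    moreover have "s * (norm m + 1) = s * norm m + s" by (simp add: algebra_simps)
    ultimately have "s * (m \<bullet> p) < m \<bullet> u" using s(1) by linarith
    then show ?thesis
      unfolding qp using s r by (simp add: inner_diff_right)
  qed
  then have "m1 \<bullet> (q - p) > 0" "m2 \<bullet> (q - p) > 0"
    using u by (auto simp: s_def)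
  ultimately show thesis by (rule that)
qed

section \<open>Critical inscribed polytopes\<close>

locale critical_triangulation = boundary_triangulation P C
  for P :: "(real^'n::finite) set" and C :: "(real^'n) set set" +
  assumes inscribed: "vertices P \<subseteq> sphere 0 1"
    and property_Z: "property_Z P"
begin

lemma vertex_norm: "p \<in> vertices P \<Longrightarrow> norm p = 1"
  using inscribed by auto

lemma P_subset_cball: "P \<subseteq> cball 0 1"
proof -
  have "convex hull (vertices P) \<subseteq> cball 0 1"
    using vertex_norm by (intro hull_minimal) auto
  then show ?thesis by (simp add: convex_hull_vertices compact_P convex_P)
qed

lemma interior_norm: "c \<in> interior P \<Longrightarrow> norm c < 1"
  using interior_mono[OF P_subset_cball] by (auto simp: interior_cball)

lemma property_Z_ball:
  assumes "p \<in> vertices P"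
  obtains \<delta> where "\<delta> > 0" "\<And>q. norm q = 1 \<Longrightarrow> norm (q - p) < \<delta> \<Longrightarrow>
    measure lebesgue (convex hull (vertices P - {p} \<union> {q})) \<le> measure lebesgue P"
proof -
  obtain U where U: "openin (top_of_set (sphere 0 1)) U" "p \<in> U"
    "\<forall>q\<in>U. measure lebesgue (convex hull (vertices P - {p} \<union> {q})) \<le> measure lebesgue P"
    using property_Z assms unfolding property_Z_def by blast
  obtain \<delta> where \<delta>: "\<delta> > 0" "\<forall>q\<in>sphere 0 1. dist q p < \<delta> \<longrightarrow> q \<in> U"
    using U(1,2) unfolding openin_euclidean_subtopology_iff by blast
  show thesis
    by (rule that[OF \<delta>(1)]) (use \<delta>(2) U(3) in \<open>auto simp: dist_norm\<close>)
qed

abbreviation volume_gradient :: "real^'n \<Rightarrow> real^'n \<Rightarrow> real^'n" where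
  "volume_gradient c \<equiv> coned_complex.gradient c K"

lemma moved_hull_admissible:
  assumes c: "c \<in> interior P" and p: "p \<in> vertices P"
  obtains \<delta> where "\<delta> > 0" "\<And>q. \<lbrakk>norm q = 1; norm (q - p) < \<delta>\<rbrakk> \<Longrightarrow>
    \<exists>W. convex W \<and> W \<in> lmeasurable \<and> c \<in> W \<and> q \<in> W \<and> \<Union>K - {p} \<subseteq> W \<and>
      measure lebesgue W \<le> measure lebesgue P \<and> coned_complex.hat_slope c K p * norm (q - p) < 1 \<and> norm (q - p) \<le> 1"
proof -
  interpret coned_complex P c K by (rule coned_complex[OF c])
  obtain \<delta>1 where \<delta>1: "\<delta>1 > 0" "\<And>q. norm q = 1 \<Longrightarrow> norm (q - p) < \<delta>1 \<Longrightarrow>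
    measure lebesgue (convex hull (vertices P - {p} \<union> {q})) \<le> measure lebesgue P"
    using property_Z_ball[OF p] by blast
  obtain \<delta>2 where \<delta>2: "\<delta>2 > 0" "\<And>p q. norm (q - p) < \<delta>2 \<Longrightarrow> c \<in> convex hull (vertices P - {p} \<union> {q})"
    using interior_point_in_moved_hull[OF c] by blast
  define \<delta> where "\<delta> = min (min \<delta>1 \<delta>2) (min 1 (1 / (hat_slope p + 1)))"
  have "\<delta> > 0" using \<delta>1(1) \<delta>2(1) hat_slope_nonneg[of p] by (simp add: \<delta>_def)
  then show thesis
  proof (rule that)
    fix q :: "real^'n" assume q: "norm q = 1" "norm (q - p) < \<delta>"
    let ?W = "convex hull (vertices P - {p} \<union> {q})"
    have cpt: "compact ?W"
      using finite_vertices by (intro finite_imp_compact_convex_hull) auto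
    have sub: "vertices P - {p} \<union> {q} \<subseteq> ?W" by (rule hull_subset)
    have "\<Union>K - {p} \<subseteq> ?W" using K_subset_vertices sub by blast
    moreover have "hat_slope p * norm (q - p) < 1"
    proof -
      have "norm (q - p) * (hat_slope p + 1) < 1"
        using q(2) hat_slope_nonneg[of p] by (simp add: \<delta>_def pos_less_divide_eq)
      moreover have "norm (q - p) * (hat_slope p + 1) = hat_slope p * norm (q - p) + norm (q - p)"
        by (simp add: algebra_simps)
      ultimately show ?thesis using norm_ge_zero[of "q - p"] by linarith
    qed
    ultimately show "\<exists>W. convex W \<and> W \<in> lmeasurable \<and> c \<in> W \<and> q \<in> W \<and> \<Union>K - {p} \<subseteq> W \<and>
      measure lebesgue W \<le> measure lebesgue P \<and> hat_slope p * norm (q - p) < 1 \<and> norm (q - p) \<le> 1"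
      using \<delta>1(2)[OF q(1)] \<delta>2(2) q(2) cpt sub
      by (intro exI[of _ ?W]) (auto simp: \<delta>_def lmeasurable_compact)
  qed
qed

text \<open>The tangential part of the gradient would be a direction of ascent of the volume. The sign of the
factor comes from the derivative towards \<open>c\<close>, the point \<open>c\<close> lying inside the ball.\<close>

lemma gradient_parallel:
  assumes c: "c \<in> interior P" and p: "p \<in> vertices P"
  shows "volume_gradient c p = (volume_gradient c p \<bullet> p) *\<^sub>R p" "volume_gradient c p \<bullet> p > 0"
proof -
  interpret coned_complex P c K by (rule coned_complex[OF c])
  let ?g = "gradient p"
  obtain \<delta> where \<delta>: "\<delta> > 0" "\<And>q. \<lbrakk>norm q = 1; norm (q - p) < \<delta>\<rbrakk> \<Longrightarrow>
    \<exists>W. convex W \<and> W \<in> lmeasurable \<and> c \<in> W \<and> q \<in> W \<and> \<Union>K - {p} \<subseteq> W \<and>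
      measure lebesgue W \<le> measure lebesgue P \<and> hat_slope p * norm (q - p) < 1 \<and> norm (q - p) \<le> 1"
    using moved_hull_admissible[OF c p] by blast
  have le: "?g \<bullet> (q - p) \<le> 0" if q: "norm q = 1" "norm (q - p) < \<delta>" for q
  proof -
    obtain W where W: "convex W" "W \<in> lmeasurable" "c \<in> W" "q \<in> W" "\<Union>K - {p} \<subseteq> W"
      "measure lebesgue W \<le> measure lebesgue P" "hat_slope p * norm (q - p) < 1"
      using \<delta>(2)[OF q] by blast
    from volume_lower_bound[OF W(1-5,7)] show ?thesis using W(6) by simp
  qed
  define w where "w = ?g - (?g \<bullet> p) *\<^sub>R p"
  have pp: "p \<bullet> p = 1" using vertex_norm[OF p] by (simp add: norm_eq_1)
  have pw: "p \<bullet> w = 0" using pp by (simp add: w_def inner_diff_right inner_commute)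
  have gw: "?g \<bullet> w = w \<bullet> w"
  proof -
    have "?g = w + (?g \<bullet> p) *\<^sub>R p" by (simp add: w_def)
    then have "?g \<bullet> w = w \<bullet> w + (?g \<bullet> p) * (p \<bullet> w)" by (metis inner_add_left inner_scaleR_left)
    then show ?thesis using pw by simp
  qed
  have "w = 0"
  proof (rule ccontr)
    assume "w \<noteq> 0"
    then have "?g \<bullet> w > 0" by (simp add: gw)
    then obtain q where "norm q = 1" "norm (q - p) < \<delta>" "?g \<bullet> (q - p) > 0"
      using sphere_ascent_two[OF vertex_norm[OF p] pw, of ?g ?g \<delta>] \<delta>(1) by blast
    then show False using le by fastforce
  qed
  then show par: "?g = (?g \<bullet> p) *\<^sub>R p" by (simp add: w_def)
  obtain B where B: "B \<in> K" "p \<in> B" by (rule vertex_in_K[OF p])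
  have "0 < (\<Sum>B\<in>{B\<in>K. p \<in> B}. cone_volume B)"
    using B finite_K cone_volume_pos by (intro sum_pos) auto
  also have "\<dots> = ?g \<bullet> (p - c)" by (rule gradient_inner_apex[symmetric])
  also have "\<dots> = (?g \<bullet> p) * (1 - p \<bullet> c)"
    by (subst par) (simp add: inner_diff_right right_diff_distrib pp)
  finally have "0 < (?g \<bullet> p) * (1 - p \<bullet> c)" .
  moreover have "p \<bullet> c < 1"
    using norm_cauchy_schwarz[of p c] vertex_norm[OF p] interior_norm[OF c] by simp
  ultimately show "?g \<bullet> p > 0" by (simp add: zero_less_mult_iff)
qed

text \<open>Exchanging the summations over vertices and simplices turns this into Minkowski's relation.\<close>

lemma sum_gradient: "c \<in> interior P \<Longrightarrow> (\<Sum>p\<in>vertices P. volume_gradient c p) = 0"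
proof -
  assume c: "c \<in> interior P"
  interpret coned_complex P c K by (rule coned_complex[OF c])
  have "(\<Sum>p\<in>vertices P. gradient p) = (\<Sum>B\<in>K. cone_volume B *\<^sub>R (\<Sum>p\<in>vertices P. dual B p))"
    unfolding gradient_def by (subst sum.swap) (simp add: scaleR_sum_right)
  also have "\<dots> = (\<Sum>B\<in>K. cone_volume B *\<^sub>R (\<Sum>p\<in>B. dual B p))"
  proof (rule sum.cong[OF refl])
    fix B assume B: "B \<in> K"
    have "(\<Sum>p\<in>vertices P. dual B p) = (\<Sum>p\<in>B. dual B p)"
      by (rule sum.mono_neutral_right[OF finite_vertices K_subset_vertices[OF B]]) auto
    then show "cone_volume B *\<^sub>R (\<Sum>p\<in>vertices P. dual B p) = cone_volume B *\<^sub>R (\<Sum>p\<in>B. dual B p)"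
      by simp
  qed
  also have "\<dots> = 0"
    by (rule sum_dual_vectors_eq_0[OF c coned_complex])
  finally show "(\<Sum>p\<in>vertices P. gradient p) = 0" .
qed

text \<open>The origin is a combination of the vertices with positive coefficients. If all of \<open>P\<close> were on one side of a
hyperplane through the origin, all vertices would lie in it.\<close>

lemma origin_interior: "0 \<in> interior P"
proof (rule ccontr)
  assume "0 \<notin> interior P"
  then obtain a where a: "a \<noteq> 0" "\<forall>x\<in>interior P. 0 \<le> a \<bullet> x"
    using separating_hyperplane_set_0[of "interior P"] convex_P by (auto simp: convex_interior)
  have "closure (interior P) \<subseteq> {x. a \<bullet> x \<ge> 0}"
    using a(2) by (intro closure_minimal closed_halfspace_ge) auto
  then have aP: "a \<bullet> x \<ge> 0" if "x \<in> P" for x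
    using that convex_closure_interior[OF convex_P interior_nonempty] closure_subset by blast
  obtain c where c: "c \<in> interior P" using interior_nonempty by blast
  let ?l = "\<lambda>p. volume_gradient c p \<bullet> p"
  have nonneg: "?l p * (a \<bullet> p) \<ge> 0" if "p \<in> vertices P" for p
    using gradient_parallel(2)[OF c that] aP[of p] that by (simp add: vertices_def extreme_point_of_def)
  have "0 = a \<bullet> (\<Sum>p\<in>vertices P. volume_gradient c p)" by (simp add: sum_gradient[OF c])
  also have "\<dots> = (\<Sum>p\<in>vertices P. ?l p * (a \<bullet> p))"
    unfolding inner_sum_right
    by (intro sum.cong refl) (subst gradient_parallel(1)[OF c], simp_all)
  finally have "\<forall>p\<in>vertices P. ?l p * (a \<bullet> p) = 0"
    using sum_nonneg_eq_0_iff[OF finite_vertices, of "\<lambda>p. ?l p * (a \<bullet> p)"] nonneg by simp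
  then have "vertices P \<subseteq> {x. a \<bullet> x = 0}"
    using gradient_parallel(2)[OF c] by fastforce
  then have "convex hull (vertices P) \<subseteq> {x. a \<bullet> x = 0}"
    by (intro hull_minimal convex_hyperplane)
  then have "interior P \<subseteq> interior {x. a \<bullet> x = 0}"
    by (intro interior_mono) (simp add: convex_hull_vertices compact_P convex_P)
  then show False using c a(1) by (simp add: interior_hyperplane)
qed

text \<open>The dual vector of \<open>p\<close> vanishes on the other vertices and is positive at \<open>p\<close>, so it points in the direction of
the required normal.\<close>

lemma opposite_normal_eq:
  assumes B: "B \<in> K" and p: "p \<in> B"
  defines "e \<equiv> dual_vector 0 B p"
  shows "e \<noteq> 0" "opposite_normal (convex hull B) p = e /\<^sub>R norm e"
proof -
  interpret coned_complex P 0 K by (rule coned_complex[OF origin_interior])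
  have ep: "e \<bullet> p = 1" and ev: "\<And>v. v \<in> B - {p} \<Longrightarrow> e \<bullet> v = 0"
    using dual_inner[OF B, of _ p] p by (auto simp: e_def)
  show e: "e \<noteq> 0" using ep by auto
  define u where "u = e /\<^sub>R norm e"
  have u: "norm u = 1" "u \<bullet> p > 0" using e ep by (auto simp: u_def)
  have hyp: "{x. u \<bullet> x = 0} = {x. e \<bullet> x = 0}" using e by (auto simp: u_def)
  have "0 \<notin> B" by (rule apex_notin[OF B])
  then have "independent B"
    using indep[OF B] by (simp add: affine_dependent_iff_dependent)
  then have indep': "independent (B - {p})" by (rule independent_mono) auto
  have "card (B - {p}) = CARD('n) - 1"
    using card_K[OF B] finite_B[OF B] p by simp
  then have "dim (B - {p}) = dim {x. e \<bullet> x = 0}"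
    using dim_eq_card_independent[OF indep'] e by (simp add: dim_hyperplane)
  moreover have "span (B - {p}) \<subseteq> {x. e \<bullet> x = 0}"
    using ev by (intro span_minimal subspace_hyperplane) auto
  ultimately have "span (B - {p}) = {x. e \<bullet> x = 0}"
    by (intro subspace_dim_equal subspace_hyperplane) auto
  moreover have vert: "(vertices (convex hull B) \<union> {0}) - {p} = insert 0 (B - {p})"
    using KD(5)[OF B] p \<open>0 \<notin> B\<close> by auto
  ultimately have aff: "affine hull ((vertices (convex hull B) \<union> {0}) - {p}) = {x. u \<bullet> x = 0}"
    by (simp add: hyp affine_hull_span_0 hull_inc span_insert_0)
  show "opposite_normal (convex hull B) p = e /\<^sub>R norm e"
    unfolding opposite_normal_def aff u_def[symmetric]
  proof (rule the_equality)
    show "norm u = 1 \<and> (\<exists>c. {x. u \<bullet> x = 0} = {x. u \<bullet> x = c} \<and> c < u \<bullet> p)"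
      using u by auto
    fix u' assume "norm u' = 1 \<and> (\<exists>c. {x. u \<bullet> x = 0} = {x. u' \<bullet> x = c} \<and> c < u' \<bullet> p)"
    then obtain c where u': "norm u' = 1" "{x. u \<bullet> x = 0} = {x. u' \<bullet> x = c}" "c < u' \<bullet> p"
      by blast
    \<comment> \<open>The spanned hyperplane passes through the origin, which fixes the offset \<open>c\<close>.\<close>
    have "0 \<in> {x. u \<bullet> x = 0}" by simp
    then have "c = 0" unfolding u'(2) by simp
    then have *: "u' = (u' \<bullet> u) *\<^sub>R u"
      using u' u(1) by (intro normal_of_subspace_unique) auto
    then have "u' \<bullet> p = (u' \<bullet> u) * (u \<bullet> p)" by (metis inner_scaleR_left)
    then have "u' \<bullet> u > 0" using u'(3) \<open>c = 0\<close> u(2) by (simp add: zero_less_mult_iff)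
    moreover have "\<bar>u' \<bullet> u\<bar> = 1" using * u'(1) u(1) by (metis mult.right_neutral norm_scaleR)
    ultimately show "u' = u" using * by simp
  qed
qed

lemma facets_at_eq:
  assumes "p \<in> vertices P"
  shows "facets_at C p = (\<lambda>B. convex hull B) ` {B\<in>K. p \<in> B}"
proof (intro set_eqI iffI)
  fix F assume F: "F \<in> facets_at C p"
  then have F': "F \<in> facets" "p \<in> F" by (auto simp: facets_at_def facets_def)
  then have "vertices F \<in> K" "convex hull (vertices F) = F"
    using facetD(2)[OF F'(1)] by (auto simp: K_def)
  moreover have "F \<subseteq> P"
    using C_subset_frontier facetD(1)[OF F'(1)] frontier_subset_closed[OF closed_P] by blast
  then have "p \<in> vertices F"
    using vertex_in_subset[OF assms, of "vertices F"] F'(2) calculation(2) by simp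
  ultimately show "F \<in> (\<lambda>B. convex hull B) ` {B\<in>K. p \<in> B}" by (metis (mono_tags) imageI mem_Collect_eq)
next
  fix F assume "F \<in> (\<lambda>B. convex hull B) ` {B\<in>K. p \<in> B}"
  then obtain B where B: "B \<in> K" "p \<in> B" "F = convex hull B" by auto
  then obtain F' where F': "F' \<in> facets" "B = vertices F'" by (auto simp: K_def)
  then have "F = F'" using B(3) facetD(2)[OF F'(1)] by simp
  moreover have "p \<in> F" using B(2,3) by (simp add: hull_inc)
  ultimately show "F \<in> facets_at C p"
    using F'(1) by (simp add: facets_at_def facets_def)
qed

text \<open>For \<open>c = 0\<close> the gradient at \<open>p\<close> and the vector \<open>m\<close> agree term by term up to the factor \<open>\<kappa>\<close>: with \<open>e\<close> the dual vector of
\<open>p\<close>, the height of \<open>p\<close> over the opposite face is \<open>1 / norm e\<close>, so that volume times \<open>e\<close> is \<open>\<kappa>\<close> times area times unit normal.\<close>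

lemma facet_normal_sum:
  assumes p: "p \<in> vertices P"
  shows "p = (let m = \<Sum>F\<in>facets_at C p. opposite_area F p *\<^sub>R opposite_normal F p in (1 / norm m) *\<^sub>R m)"
proof -
  interpret coned_complex P 0 K by (rule coned_complex[OF origin_interior])
  obtain \<kappa> where \<kappa>: "\<kappa> > 0"
    "\<And>(B :: (real^'n) set) u p. \<lbrakk>independent B; Suc (card B) = CARD('n); norm u = 1;
       \<And>v. v \<in> B \<Longrightarrow> u \<bullet> v = 0; u \<bullet> p > 0\<rbrakk> \<Longrightarrow>
     measure lebesgue (convex hull (insert p (insert 0 B))) =
       \<kappa> * ((u \<bullet> p) * k_volume (CARD('n) - 1) (convex hull (insert 0 B)))"
    by (rule simplex_volume_eq_k_volume) blast
  let ?m = "\<Sum>F\<in>facets_at C p. opposite_area F p *\<^sub>R opposite_normal F p"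
  have inj: "inj_on (\<lambda>B. convex hull B) {B\<in>K. p \<in> B}"
    by (rule inj_onI) (metis KD(5) mem_Collect_eq)
  have summand: "cone_volume B *\<^sub>R dual B p =
      \<kappa> *\<^sub>R (opposite_area (convex hull B) p *\<^sub>R opposite_normal (convex hull B) p)"
    if B: "B \<in> K" "p \<in> B" for B
  proof -
    let ?e = "dual B p"
    define u where "u = ?e /\<^sub>R norm ?e"
    have e: "?e \<noteq> 0" and normal: "opposite_normal (convex hull B) p = u"
      using opposite_normal_eq[OF B] by (auto simp: u_def)
    have "0 \<notin> B" by (rule apex_notin[OF B(1)])
    then have "independent B"
      using indep[OF B(1)] by (simp add: affine_dependent_iff_dependent)
    then have ind: "independent (B - {p})" by (rule independent_mono) auto
    have card: "Suc (card (B - {p})) = CARD('n)"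
      using card_K[OF B(1)] finite_B[OF B(1)] B(2) card_Suc_Diff1 by metis
    have up: "u \<bullet> p = 1 / norm ?e"
      using dual_inner[OF B, of p] by (simp add: u_def inverse_eq_divide)
    have uv: "u \<bullet> v = 0" if "v \<in> B - {p}" for v
      using dual_inner[OF B(1), of v p] that by (simp add: u_def)
    have u: "norm u = 1" using e by (simp add: u_def)
    have "u \<bullet> p > 0" using e by (simp add: up)
    from \<kappa>(2)[OF ind card u uv this]
    have "measure lebesgue (convex hull (insert p (insert 0 (B - {p})))) =
        \<kappa> * ((1 / norm ?e) * k_volume (CARD('n) - 1) (convex hull (insert 0 (B - {p}))))"
      by (simp only: up)
    moreover have "insert p (insert 0 (B - {p})) = insert 0 B" using B(2) by auto
    moreover have "(vertices (convex hull B) \<union> {0}) - {p} = insert 0 (B - {p})"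
      using KD(5)[OF B(1)] B(2) \<open>0 \<notin> B\<close> by auto
    ultimately have "cone_volume B = \<kappa> * ((1 / norm ?e) * opposite_area (convex hull B) p)"
      by (simp add: opposite_area_def)
    then show ?thesis
      unfolding normal u_def by (simp add: inverse_eq_divide)
  qed
  have "gradient p = (\<Sum>B\<in>{B\<in>K. p \<in> B}. cone_volume B *\<^sub>R dual B p)"
    unfolding gradient_def by (rule sum.mono_neutral_right) (auto simp: finite_K)
  also have "\<dots> = (\<Sum>B\<in>{B\<in>K. p \<in> B}.
      \<kappa> *\<^sub>R (opposite_area (convex hull B) p *\<^sub>R opposite_normal (convex hull B) p))"
    by (intro sum.cong refl summand) auto
  also have "\<dots> = \<kappa> *\<^sub>R ?m"
    unfolding facets_at_eq[OF p] sum.reindex[OF inj] o_def by (simp add: scaleR_sum_right)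
  finally have g: "gradient p = \<kappa> *\<^sub>R ?m" .
  let ?l = "gradient p \<bullet> p"
  note par = gradient_parallel[OF origin_interior p]
  have "?m = (1 / \<kappa>) *\<^sub>R (\<kappa> *\<^sub>R ?m)" using \<kappa>(1) by simp
  also have "\<dots> = (?l / \<kappa>) *\<^sub>R p"
    unfolding g[symmetric] by (subst par(1)) simp
  finally have m: "?m = (?l / \<kappa>) *\<^sub>R p" .
  have pos: "?l / \<kappa> > 0" using par(2) \<kappa>(1) by simp
  have "norm ?m = ?l / \<kappa>" 
    using abs_of_pos[OF pos] by (simp only: m norm_scaleR vertex_norm[OF p] mult_1_right)
  then have "(1 / norm ?m) *\<^sub>R ?m = p"
    using pos par(2) \<kappa>(1) by (subst (2) m) simp
  then show ?thesis by (simp add: Let_def)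
qed

text \<open>The cone over the facet has positive volume and is covered by the cones over the simplices of \<open>C\<close>. A simplex not contained
in \<open>G\<close> meets \<open>G\<close> in a proper face, which contributes volume zero.\<close>

lemma facet_contains_K:
  assumes G: "G facet_of P"
  obtains B n b where "B \<in> K" "B \<subseteq> G" "\<And>x. x \<in> P \<Longrightarrow> n \<bullet> x \<le> b" "G = P \<inter> {x. n \<bullet> x = b}" "0 < b"
proof -
  have face: "G face_of P" "G \<noteq> {}" "aff_dim G = aff_dim P - 1"
    using G by (auto simp: facet_of_def)
  have "G exposed_face_of P"
    using face(1) exposed_face_of_polyhedron[OF polytope_imp_polyhedron[OF polytope_P]] by simp
  then obtain n b where n: "P \<subseteq> {x. n \<bullet> x \<le> b}" "G = P \<inter> {x. n \<bullet> x = b}"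
    by (auto simp: exposed_face_of_def)
  have "G \<inter> interior P = {}"
    using face by (intro face_of_disjoint_interior) auto
  then have "0 \<notin> G" using origin_interior by blast
  moreover have "0 \<in> P" using origin_interior interior_subset by blast
  ultimately have b: "0 < b" using n by force
  have GP: "G \<subseteq> frontier P"
    using \<open>G \<inter> interior P = {}\<close> n(2) closed_P by (auto simp: frontier_def closure_closed)
  have G_hull: "convex hull G = G"
    using face(1) face_of_imp_convex hull_same by blast
  have "\<exists>B\<in>K. B \<subseteq> G"
  proof (rule ccontr)
    assume none: "\<not> (\<exists>B\<in>K. B \<subseteq> G)"
    have "negligible (convex hull (insert 0 G) \<inter> convex hull (insert 0 B))" if B: "B \<in> K" for B
    proof -
      have "finite B" using KD(3)[OF B] by (rule aff_independent_finite)
      have BP: "convex hull B \<subseteq> P"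
        using KD(2)[OF B] frontier_subset_closed[OF closed_P] by blast
      then have "(convex hull B \<inter> {x. n \<bullet> x = b}) face_of (convex hull B)"
        using n(1) by (intro face_of_Int_supporting_hyperplane_le) auto
      then obtain T where T: "T \<subseteq> B" "convex hull B \<inter> {x. n \<bullet> x = b} = convex hull T"
        using face_of_convex_hull_subset[OF finite_imp_compact[OF \<open>finite B\<close>]] by metis
      have "T \<noteq> B"
      proof
        assume "T = B"
        then have "B \<subseteq> G" using T(2) BP n(2) hull_subset[of B convex] by blast
        then show False using none B by blast
      qed
      then have "card T < CARD('n)"
        using T(1) KD(4)[OF B] \<open>finite B\<close> by (metis psubsetI psubset_card_mono)
      moreover have fT: "finite T" using T(1) \<open>finite B\<close> finite_subset by blast
      ultimately have "negligible (convex hull (insert 0 T))"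
        by (intro negligible_convex_hull_card) (auto simp: card_insert_if)
      moreover have "convex hull G \<inter> convex hull B \<subseteq> convex hull T"
      proof -
        have "G \<subseteq> {x. n \<bullet> x = b}" using n(2) by blast
        then show ?thesis unfolding G_hull T(2)[symmetric] by blast
      qed
      then have "convex hull (insert 0 G) \<inter> convex hull (insert 0 B) \<subseteq> convex hull (insert 0 T)"
        using cones_meet[OF convex_P closed_P origin_interior, of G B T] GP KD(2)[OF B] by (simp add: G_hull)
      ultimately show ?thesis by (rule negligible_subset)
    qed
    then have "negligible (\<Union>B\<in>K. convex hull (insert 0 G) \<inter> convex hull (insert 0 B))"
      by (intro negligible_Union) (auto simp: finite_K)
    moreover have "convex hull (insert 0 G) \<subseteq> P"
      using \<open>0 \<in> P\<close> n(2) by (intro hull_minimal convex_P) auto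
    then have "convex hull (insert 0 G) \<subseteq> (\<Union>B\<in>K. convex hull (insert 0 G) \<inter> convex hull (insert 0 B))"
      using cover[OF origin_interior] by blast
    ultimately have negl: "negligible (convex hull (insert 0 G))"
      by (rule negligible_subset)
    have "affine hull G \<subseteq> {x. n \<bullet> x = b}"
      using n(2) by (intro hull_minimal affine_hyperplane) auto
    then have "0 \<notin> affine hull G" using b by auto
    then have "aff_dim (convex hull (insert 0 G)) = int CARD('n)"
      using face(3) full_dim by (simp only: aff_dim_convex_hull aff_dim_insert if_False)
    then have "affine hull (convex hull (insert 0 G)) = UNIV"
      using aff_dim_eq_full[of "convex hull (insert 0 G)"] by simp
    then have "rel_interior (convex hull (insert 0 G)) = interior (convex hull (insert 0 G))"
      by (rule rel_interior_interior)
    moreover have "rel_interior (convex hull (insert 0 G)) \<noteq> {}"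
      by (simp add: rel_interior_eq_empty)
    ultimately show False
      using negl negligible_convex_interior[of "convex hull (insert 0 G)"] by simp
  qed
  then show thesis using that n b by blast
qed

text \<open>If \<open>G\<close> has a vertex \<open>p\<close> outside the simplex with vertex set \<open>B\<close>, move \<open>p\<close> on the sphere in the direction of the tangential
part \<open>w\<close> of the outer normal. The volume then increases at first order: the gradient at \<open>p\<close> is orthogonal to \<open>w\<close>, but the
simplex erected over \<open>B\<close> gains. The tangential part vanishes only if \<open>G\<close> is a single point.\<close>

lemma facet_simplex:
  assumes G: "G facet_of P"
  shows "\<exists>k. k simplex G"
proof (rule ccontr)
  assume not_simplex: "\<not> (\<exists>k. k simplex G)"
  interpret coned_complex P 0 K by (rule coned_complex[OF origin_interior])
  obtain B n b where B: "B \<in> K" "B \<subseteq> G" and nP: "\<And>x. x \<in> P \<Longrightarrow> n \<bullet> x \<le> b"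
    and G_eq: "G = P \<inter> {x. n \<bullet> x = b}" and b: "0 < b"
    using facet_contains_K[OF G] by metis
  have face: "G face_of P" "G \<noteq> {}" using G by (auto simp: facet_of_def)
  have "convex G" "compact G"
    using face(1) convex_P compact_P by (auto intro: face_of_imp_convex face_of_imp_compact)
  then have G_hull: "convex hull (vertices G) = G" by (simp add: convex_hull_vertices)
  have "\<not> vertices G \<subseteq> B"
  proof
    assume "vertices G \<subseteq> B"
    then have "G \<subseteq> convex hull B" using G_hull hull_mono by metis
    moreover have "convex hull B \<subseteq> G" using B(2) \<open>convex G\<close> by (rule hull_minimal)
    ultimately have "G = convex hull B" by blast
    then have "(int CARD('n) - 1) simplex G"
      using KD(3,4)[OF B(1)] by (auto simp: simplex_def)
    then show False using not_simplex by blast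
  qed
  then obtain p where p: "p \<in> vertices G" "p \<notin> B" by blast
  then have pV: "p \<in> vertices P" "p \<in> G"
    using extreme_point_of_face[OF face(1), of p] by (auto simp: vertices_def)
  have np: "n \<bullet> p = b" using pV G_eq by auto
  have nB: "n \<bullet> v = b" if "v \<in> B" for v using that B(2) G_eq by auto
  obtain \<eta> where \<eta>: "\<eta> > 0"
    "\<And>q W. \<lbrakk>hat_slope p * norm (q - p) < 1; norm (q - p) \<le> 1; n \<bullet> q \<ge> b; convex W; W \<in> lmeasurable;
       0 \<in> W; q \<in> W; \<Union>K - {p} \<subseteq> W\<rbrakk> \<Longrightarrow>
     measure lebesgue P + gradient p \<bullet> (q - p) + \<eta> * (n \<bullet> (q - p)) \<le> measure lebesgue W"
    using volume_lower_bound_strict[OF B(1) p(2) nB nP _ np] b by (metis inner_zero_right)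
  obtain \<delta> where \<delta>: "\<delta> > 0" "\<And>q. \<lbrakk>norm q = 1; norm (q - p) < \<delta>\<rbrakk> \<Longrightarrow>
    \<exists>W. convex W \<and> W \<in> lmeasurable \<and> 0 \<in> W \<and> q \<in> W \<and> \<Union>K - {p} \<subseteq> W \<and>
      measure lebesgue W \<le> measure lebesgue P \<and> hat_slope p * norm (q - p) < 1 \<and> norm (q - p) \<le> 1"
    using moved_hull_admissible[OF origin_interior pV(1)] by blast
  define m where "m = gradient p + \<eta> *\<^sub>R n"
  have le: "m \<bullet> (q - p) \<le> 0" if q: "norm q = 1" "norm (q - p) < \<delta>" and nq: "n \<bullet> (q - p) > 0" for q
  proof -
    obtain W where W: "convex W" "W \<in> lmeasurable" "0 \<in> W" "q \<in> W" "\<Union>K - {p} \<subseteq> W"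
      "measure lebesgue W \<le> measure lebesgue P" "hat_slope p * norm (q - p) < 1" "norm (q - p) \<le> 1"
      using \<delta>(2)[OF q] by blast
    have "n \<bullet> q \<ge> b" using nq np by (simp add: inner_diff_right)
    from \<eta>(2)[OF W(7,8) this W(1-5)] show ?thesis
      using W(6) by (simp add: m_def inner_add_left)
  qed
  define w where "w = n - (n \<bullet> p) *\<^sub>R p"
  have pp: "p \<bullet> p = 1" using vertex_norm[OF pV(1)] by (simp add: norm_eq_1)
  have pw: "p \<bullet> w = 0" using pp by (simp add: w_def inner_diff_right inner_commute)
  have nw: "n \<bullet> w = w \<bullet> w"
  proof -
    have "n = w + (n \<bullet> p) *\<^sub>R p" by (simp add: w_def)
    then have "n \<bullet> w = w \<bullet> w + (n \<bullet> p) * (p \<bullet> w)" by (metis inner_add_left inner_scaleR_left)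
    then show ?thesis using pw by simp
  qed
  have "w \<noteq> 0"
  proof
    assume "w = 0"
    then have n_eq: "n = b *\<^sub>R p" using np by (simp add: w_def)
    \<comment> \<open>The hyperplane of \<open>G\<close> would touch the unit ball, which contains \<open>P\<close>, at \<open>p\<close> only.\<close>
    have "x = p" if "x \<in> G" for x
    proof -
      have "b * (p \<bullet> x) = b" using that G_eq by (auto simp: n_eq)
      then have "p \<bullet> x = 1" using b by simp
      moreover have "norm x \<le> 1" using that G_eq P_subset_cball by auto
      then have "x \<bullet> x \<le> 1" by (simp add: dot_square_norm power_le_one)
      ultimately have "(x - p) \<bullet> (x - p) \<le> 0"
        using pp by (simp add: inner_diff_left inner_diff_right inner_commute)
      then have "(x - p) \<bullet> (x - p) = 0" using inner_ge_zero[of "x - p"] by linarith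
      then show ?thesis by simp
    qed
    then have "G = {p}" using pV(2) by blast
    then show False using not_simplex by simp
  qed
  then have "n \<bullet> w > 0" by (simp add: nw)
  moreover have "m \<bullet> w > 0"
  proof -
    have "gradient p \<bullet> w = 0"
      by (subst gradient_parallel(1)[OF origin_interior pV(1)]) (simp add: pw)
    then show ?thesis using \<open>n \<bullet> w > 0\<close> \<eta>(1) by (simp add: m_def inner_add_left)
  qed
  ultimately obtain q where "norm q = 1" "norm (q - p) < \<delta>" "n \<bullet> (q - p) > 0" "m \<bullet> (q - p) > 0"
    using sphere_ascent_two[OF vertex_norm[OF pV(1)] pw _ _ \<delta>(1)] by blast
  then show False using le by fastforce
qed

end

theorem lemma1:
  fixes P :: "(real ^ 'd) set" and C :: "(real ^ 'd) set set" and n :: nat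
  assumes "P \<in> inscribed_polytopes n"
    and "property_Z P"
    and "simplicial_complex C"
    and "\<Union>C = frontier P"
    and "complex_vertices C = vertices P"
  shows "(\<forall>p \<in> vertices P.
            let m = \<Sum>F\<in>facets_at C p. opposite_area F p *\<^sub>R opposite_normal F p
            in p = (1 / norm m) *\<^sub>R m) \<and>
         simplicial_polytope P"
proof -
  interpret critical_triangulation P C
    using assms by unfold_locales (auto simp: inscribed_polytopes_def)
  show ?thesis
    using facet_normal_sum facet_simplex polytope_P
    unfolding simplicial_polytope_def Let_def by blast
qed

end
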